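(* Assume that Assumption (E) (defined in the context) holds true, let $\nu_{QSD}$ and $\eta$ be as in the context, and set $E'=\{x\in E:\eta(x)>0\}$. Then $$E'=\{x\in E:\exists k\ge0,\ P_k\varphi_2(x)>0\}$$ and the domain of attraction of $\nu_{QSD}$ for the total variation norm contains all probability measures $\mu$ on $E$ such that $\mu(E')>0$ and $\mu(\varphi_1^{1/p})<+\infty$ for some $p\geq 1$ with $p<\log\theta_1/\log\theta_2$. If in addition $\varphi_1$ is bounded, then the domain of attraction of $\nu_{QSD}$ is the set of probability measures $\mu$ on $E$ such that $\mu(E')>0$, and $\nu_{QSD}$ is the unique quasi-stationary distribution giving positive mass to $E'$.
   Context: Setting. $E$ is a measurable space, $\partial\notin E$, $I$ is $\mathbb{R}_+$ or $\frac1k\mathbb{Z}_+$ for some $k\in\mathbb{N}=\{1,2,\ldots\}$, and $(X_t)_{t\in I}$ is a time-homogeneous Markov process in $E\cup\{\partial\}$, with law $\mathbb{P}_x$ when started from $x$, and $\mathbb{P}_\mu=\int\mathbb{P}_x\,\mu(\mathrm dx)$. The point $\partial$ is absorbing: $X_t=\partial$ for all $t\ge\tau_\partial:=\inf\{t\in I:X_t=\partial\}$ almost surely. For $n\in\mathbb{Z}_+$, $P_nf(x)=\mathbb{E}_x(f(X_n)\mathbf{1}_{n<\tau_\partial})$. Also $\mu(f)=\int f\,\mathrm d\mu$. Assumption (E). There exist a positive integer $n_1$, positive real constants $\theta_1,\theta_2,c_1,c_2,c_3$, two measurable functions $\varphi_1,\varphi_2:E\to\mathbb{R}_+$ and a probability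 measure $\nu$ on a measurable subset $K\subset E$ such that: - (E1) for all $x\in K$, $\mathbb{P}_x(X_{n_1}\in\cdot)\ge c_1\nu(\cdot\cap K)$. - (E2) $\theta_1<\theta_2$, $\inf_E\varphi_1\ge1$, $\sup_K\varphi_1<\infty$, $\inf_K\varphi_2>0$, $\sup_E\varphi_2\le1$, and for all $x\in E$, $P_1\varphi_1(x)\le\theta_1\varphi_1(x)+c_2\mathbf{1}_K(x)$ and $P_1\varphi_2(x)\ge\theta_2\varphi_2(x)$. - (E3) $\displaystyle\sup_{n\in\mathbb{Z}_+}\frac{\sup_{y\in K}\mathbb{P}_y(n<\tau_\partial)}{\inf_{y\in K}\mathbb{P}_y(n<\tau_\partial)}\le c_3$. - (E4) for all $x\in K$ there exists $n_4(x)$ such that $\mathbb{P}_x(X_n\in K)>0$ for all $n\ge n_4(x)$. (These imply $\theta_1<\theta_2\le1$; when $\theta_2=1$, $\log\theta_1/\log\theta_2$ is read as $+\infty$.) A quasi-stationary distribution is a probability measure $\nu'$ on $E$ such that $\mathbb{P}_{\nu'}(X_n\in\cdot\mid n<\tau_\partial)=\nu'$ for all $n\in\mathbb{Z}_+$. Under Assumption (E), there is a unique quasi-stationary distribution $\nu_{QSD}$ with $\nu_{QSD}(\varphi_1)<\infty$ and $\nu_{QSD}(\varphi_2)>0$. The number $\theta_0\in(0,1]$ is defined by $\mathbb{P}_{\nu_{QSD}}(n<\tau_\partial)=\theta_0^n$ for all $n\in\mathbb{N}$, and the limit $\eta(x)=\lim_{n\to+\infty}\theta_0^{-n}\mathbb{P}_x(n<\tau_\partial)\in[0,\infty)$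 exists for every $x\in E$. The domain of attraction of $\nu_{QSD}$ is the set of probability measures $\mu$ on $E$ such that $\mathbb{P}_\mu(X_n\in\cdot\mid n<\tau_\partial)$ converges to $\nu_{QSD}$ in total variation norm as $n\to+\infty$, $n\in\mathbb{Z}_+$. *)

theory Defs
  imports "HOL-Probability.Probability"
begin

text \<open>
  The state space is the set \<open>space (stateM X) \<union> {\<partial>}\<close>, where \<open>stateM X\<close> serves only as a
  measurable space (its measure is never used), and \<open>\<partial> = cem X\<close>.
  The set \<open>times X\<close> is the set \<open>I\<close> of times; paths and filtration are irrelevant outside it.
\<close>

record ('w, 'a) process =
  stateM :: "'a measure"
  cem :: 'a
  times :: "real set"
  omega :: "'w measure"
  filtr :: "real \<Rightarrow> 'w measure"
  path :: "real \<Rightarrow> 'w \<Rightarrow> 'a"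
  law :: "'a \<Rightarrow> 'w measure"

definition extM :: "('w, 'a, 'z) process_scheme \<Rightarrow> 'a measure" where
  "extM X = sigma (insert (cem X) (space (stateM X))) (insert {cem X} (sets (stateM X)))"

definition absorption_time :: "('w, 'a, 'z) process_scheme \<Rightarrow> 'w \<Rightarrow> ereal" where
  "absorption_time X \<omega> = (INF t \<in> {t \<in> times X. path X t \<omega> = cem X}. ereal t)"

locale absorbed_markov_process =
  fixes X :: "('w, 'a, 'z) process_scheme"
  assumes cem_notin: "cem X \<notin> space (stateM X)"
    and times: "times X = {0..} \<or> (\<exists>k::nat. k \<ge> 1 \<and> times X = range (\<lambda>n::nat. real n / real k))"
    and law_kernel: "law X \<in> measurable (extM X) (prob_algebra (omega X))"
    and filtration: "\<And>t. t \<in> times X \<Longrightarrow> subalgebra (omega X) (filtr X t)"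
      "\<And>s t. s \<in> times X \<Longrightarrow> t \<in> times X \<Longrightarrow> s \<le> t \<Longrightarrow> sets (filtr X s) \<subseteq> sets (filtr X t)"
    and adapted: "\<And>t. t \<in> times X \<Longrightarrow> path X t \<in> measurable (filtr X t) (extM X)"
    and start: "\<And>x. x \<in> space (extM X) \<Longrightarrow> distr (law X x) (extM X) (path X 0) = return (extM X) x"
    and markov: "\<And>x s t B. x \<in> space (extM X) \<Longrightarrow> s \<in> times X \<Longrightarrow> t \<in> times X \<Longrightarrow> B \<in> sets (extM X) \<Longrightarrow>
      AE \<omega> in law X x.
        real_cond_exp (law X x) (filtr X s) (indicator (path X (s + t) -` B \<inter> space (omega X))) \<omega>
          = measure (law X (path X s \<omega>)) (path X t -` B \<inter> space (omega X))"
    and absorbed: "\<And>x. x \<in> space (extM X) \<Longrightarrow>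
      AE \<omega> in law X x. \<forall>t\<in>times X. absorption_time X \<omega> \<le> ereal t \<longrightarrow> path X t \<omega> = cem X"

text \<open>
  In continuous time \<open>{n < \<tau>}\<close> need not be in \<open>sets (omega X)\<close>. By absorption it differs
  from the measurable event \<open>{path X n \<noteq> \<partial>}\<close> by a \<open>law X x\<close>-negligible set for every \<open>x\<close>,
  so it gets its probability from the completion of \<open>law X x\<close>.
  On \<open>sets (omega X)\<close> the completion agrees with \<open>law X x\<close>.
\<close>

definition prob_from :: "('w, 'a, 'z) process_scheme \<Rightarrow> 'a \<Rightarrow> 'w set \<Rightarrow> real" where
  "prob_from X x A = measure (completion (law X x)) A"

definition prob_init :: "('w, 'a, 'z) process_scheme \<Rightarrow> 'a measure \<Rightarrow> 'w set \<Rightarrow> real" where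
  "prob_init X \<mu> A = (\<integral>x. prob_from X x A \<partial>\<mu>)"

definition hits :: "('w, 'a, 'z) process_scheme \<Rightarrow> nat \<Rightarrow> 'a set \<Rightarrow> 'w set" where
  "hits X n A = {\<omega> \<in> space (omega X). path X (real n) \<omega> \<in> A}"

definition alive :: "('w, 'a, 'z) process_scheme \<Rightarrow> nat \<Rightarrow> 'w set" where
  "alive X n = {\<omega> \<in> space (omega X). ereal (real n) < absorption_time X \<omega>}"

definition semigrp :: "('w, 'a, 'z) process_scheme \<Rightarrow> nat \<Rightarrow> ('a \<Rightarrow> real) \<Rightarrow> 'a \<Rightarrow> ennreal" where
  "semigrp X n f x =
     (\<integral>\<^sup>+ \<omega>. ennreal (f (path X (real n) \<omega>)) * indicator (alive X n) \<omega> \<partial>completion (law X x))"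

text \<open>
  If the conditioning event has probability zero, division by zero makes the following set
  function identically zero. It is then at total variation distance \<open>1\<close> from any probability
  measure, so such a \<open>\<mu>\<close> is neither quasi-stationary nor in a domain of attraction.
\<close>

definition cond_law :: "('w, 'a, 'z) process_scheme \<Rightarrow> 'a measure \<Rightarrow> nat \<Rightarrow> 'a set \<Rightarrow> real" where
  "cond_law X \<mu> n A = prob_init X \<mu> (hits X n A \<inter> alive X n) / prob_init X \<mu> (alive X n)"

definition quasi_stationary :: "('w, 'a, 'z) process_scheme \<Rightarrow> 'a measure \<Rightarrow> bool" where
  "quasi_stationary X \<nu> \<longleftrightarrow> \<nu> \<in> space (prob_algebra (stateM X)) \<and>
     (\<forall>n. \<forall>A\<in>sets (stateM X). cond_law X \<nu> n A = measure \<nu> A)"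

text \<open>Total variation norm of a real-valued set function on the measurable space \<open>M\<close>.\<close>

definition tv_norm :: "'a measure \<Rightarrow> ('a set \<Rightarrow> real) \<Rightarrow> ennreal" where
  "tv_norm M m =
     (SUP \<P> \<in> {\<P>. finite \<P> \<and> \<P> \<subseteq> sets M \<and> disjoint \<P> \<and> \<Union>\<P> = space M}.
        ennreal (\<Sum>A\<in>\<P>. \<bar>m A\<bar>))"

definition domain_of_attraction :: "('w, 'a, 'z) process_scheme \<Rightarrow> 'a measure \<Rightarrow> 'a measure set" where
  "domain_of_attraction X \<nu> =
     {\<mu> \<in> space (prob_algebra (stateM X)).
        (\<lambda>n. tv_norm (stateM X) (\<lambda>A. cond_law X \<mu> n A - measure \<nu> A)) \<longlonglongrightarrow> 0}"

text \<open>
  In (E3) the quotient is the one of \<^typ>\<open>ennreal\<close>, so it is infinite if its denominator vanishes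
  and its numerator does not.
\<close>

locale assumption_E =
  fixes X :: "('w, 'a, 'z) process_scheme"
    and n1 :: nat and \<theta>1 \<theta>2 c1 c2 c3 :: real
    and \<phi>1 \<phi>2 :: "'a \<Rightarrow> real" and \<nu> :: "'a measure" and K :: "'a set"
  assumes n1_pos: "n1 > 0"
    and consts_pos: "\<theta>1 > 0" "\<theta>2 > 0" "c1 > 0" "c2 > 0" "c3 > 0"
    and phi_measurable: "\<phi>1 \<in> borel_measurable (stateM X)" "\<phi>2 \<in> borel_measurable (stateM X)"
    and phi_nonneg: "\<And>x. x \<in> space (stateM X) \<Longrightarrow> \<phi>1 x \<ge> 0" "\<And>x. x \<in> space (stateM X) \<Longrightarrow> \<phi>2 x \<ge> 0"
    and K_sets: "K \<in> sets (stateM X)"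
    and nu_prob: "\<nu> \<in> space (prob_algebra (restrict_space (stateM X) K))"
    and E1: "\<And>x A. x \<in> K \<Longrightarrow> A \<in> sets (extM X) \<Longrightarrow>
      prob_from X x (hits X n1 A) \<ge> c1 * measure \<nu> (A \<inter> K)"
    and E2_theta: "\<theta>1 < \<theta>2"
    and E2_phi1: "\<And>x. x \<in> space (stateM X) \<Longrightarrow> \<phi>1 x \<ge> 1" "bdd_above (\<phi>1 ` K)"
    and E2_phi2: "(INF x\<in>K. \<phi>2 x) > 0" "\<And>x. x \<in> space (stateM X) \<Longrightarrow> \<phi>2 x \<le> 1"
    and E2_P1_phi1: "\<And>x. x \<in> space (stateM X) \<Longrightarrow>
      semigrp X 1 \<phi>1 x \<le> ennreal (\<theta>1 * \<phi>1 x + c2 * indicator K x)"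
    and E2_P1_phi2: "\<And>x. x \<in> space (stateM X) \<Longrightarrow>
      semigrp X 1 \<phi>2 x \<ge> ennreal (\<theta>2 * \<phi>2 x)"
    and E3: "(SUP n. (SUP y\<in>K. ennreal (prob_from X y (alive X n))) /
                     (INF y\<in>K. ennreal (prob_from X y (alive X n)))) \<le> ennreal c3"
    and E4: "\<And>x. x \<in> K \<Longrightarrow> \<exists>n4::nat. \<forall>n\<ge>n4. prob_from X x (hits X n K) > 0"

text \<open>The quotient \<open>log \<theta>1 / log \<theta>2\<close>, used for \<open>0 < \<theta>1 < \<theta>2 \<le> 1\<close>.\<close>

definition log_quotient :: "real \<Rightarrow> real \<Rightarrow> ereal" where
  "log_quotient \<theta>1 \<theta>2 = (if \<theta>2 = 1 then \<infinity> else ereal (ln \<theta>1 / ln \<theta>2))"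

end

theory Submission
  imports Defs
begin

text \<open>
  Write \<open>P\<close> for the one-step kernel of the process killed at \<open>\<partial>\<close>, \<open>\<alpha>\<close> for \<open>\<nu>QSD\<close>, and \<open>Q = P / \<theta>0\<close>. Then
  \<open>\<alpha> Q = \<alpha>\<close>, and the functions \<open>u n = Q\<^sup>n 1\<close> converge pointwise to \<open>\<eta>\<close>. Testing
  \<open>P \<phi>2 \<ge> \<theta>2 \<phi>2\<close> against \<open>\<alpha>\<close> gives \<open>\<theta>2 \<le> \<theta>0\<close>, so \<open>\<phi>1\<close> is contracted by \<open>Q\<close> outside \<open>K\<close> with the
  factor \<open>\<theta>1 / \<theta>0 < 1\<close>.

  This drift together with (E3) bounds every \<open>u n\<close> by a multiple of \<open>\<phi>1\<close>: (E3) compares \<open>u n\<close> on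
  \<open>K\<close> with its mean value \<open>1\<close> under \<open>\<alpha>\<close>, and outside \<open>K\<close> the drift propagates the bound. Dominated
  convergence yields \<open>Q \<eta> = \<eta>\<close> and \<open>\<alpha>(\<eta>) = 1\<close>, and (E3) then makes \<open>\<eta>\<close> positive on \<open>K\<close>. A point that
  never reaches \<open>K\<close> sees \<open>Q\<^sup>n \<phi>1\<close> decay like \<open>(\<theta>1 / \<theta>0)\<^sup>n\<close>, which is incompatible both with
  \<open>Q \<eta> = \<eta>\<close> at a positive value and with the slower decay of \<open>\<phi>2\<close>. Hence \<open>\<eta> > 0\<close>, the possibility of
  reaching \<open>K\<close>, and \<open>P\<^sup>k \<phi>2 > 0\<close> for some \<open>k\<close> are the same property.

  Convergence is shown by a coupling of measures in which \<open>\<eta>\<close> measures the uncoupled part. Since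
  \<open>Q \<eta> = \<eta>\<close>, the mass \<open>a(\<eta>)\<close> is preserved by \<open>Q\<close>. If \<open>a(\<phi>1) \<le> R a(\<eta>)\<close>, the drift forces
  \<open>a Q\<^sup>j\<close> to charge \<open>K\<close> substantially at some time \<open>j\<close> bounded in terms of \<open>R\<close>; by (E1) it then
  dominates a multiple of \<open>\<nu>\<close>, and by (E4) this still holds at a later time \<open>N\<close> depending on \<open>R\<close>
  only (\<open>minorization\<close>). Starting from \<open>\<mu>\<close> and \<open>\<mu>(\<eta>) \<alpha>\<close>, one removes a common multiple of \<open>\<nu>\<close>
  from both measures again and again, until their remainders \<open>a\<close> and \<open>b\<close> have \<open>\<eta>\<close>-mass at most
  \<open>\<epsilon>\<close> (\<open>coupling\<close>). The difference of the two images after \<open>k\<close> further steps is \<open>a Q\<^sup>k - b Q\<^sup>k\<close>, whose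
  total variation is at most \<open>a(u k) + b(u k)\<close>. Letting \<open>k\<close> tend to infinity, this tends to
  \<open>a(\<eta>) + b(\<eta>) \<le> 2 \<epsilon>\<close>. So \<open>\<theta>0\<^sup>-\<^sup>n \<mu> P\<^sup>n\<close> converges to \<open>\<mu>(\<eta>) \<alpha>\<close> in total variation
  (\<open>convergence_to_alpha\<close>), on all of \<open>E\<close> and not only where \<open>\<eta> > 0\<close>; dividing by the total mass gives the
  conditional laws when \<open>\<mu>(\<eta>) > 0\<close>, that is, when \<open>\<mu>(E') > 0\<close>.

  The argument applies to any function with a drift factor below \<open>\<theta>0\<close>. By Jensen's inequality
  \<open>\<phi>1 powr (1 / p)\<close> satisfies the drift condition with \<open>\<theta>1 powr (1 / p)\<close> instead of \<open>\<theta>1\<close>, and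
  \<open>p < log \<theta>1 / log \<theta>2\<close> says precisely that this factor is below \<open>\<theta>2\<close>. If \<open>\<mu>(E') = 0\<close>, the
  set \<open>{\<phi>2 > 0}\<close> is never charged from \<open>\<mu>\<close>, whereas \<open>\<alpha>\<close> charges it; this excludes attraction.
\<close>

section \<open>Subtracting a minorant from a measure\<close>

lemma nn_integral_eq_add_measures:
  assumes sets: "sets m = sets M" "sets a = sets M" "sets b = sets M"
    and eq: "\<And>A. A \<in> sets M \<Longrightarrow> emeasure m A = emeasure a A + emeasure b A"
    and f: "f \<in> borel_measurable M"
  shows "(\<integral>\<^sup>+x. f x \<partial>m) = (\<integral>\<^sup>+x. f x \<partial>a) + (\<integral>\<^sup>+x. f x \<partial>b)"
proof -
  have mb [simp]: "borel_measurable m = borel_measurable M" "borel_measurable a = borel_measurable M"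
    "borel_measurable b = borel_measurable M"
    using sets by (auto cong: measurable_cong_sets)
  show ?thesis
    using f
  proof (induction rule: borel_measurable_induct)
    case (cong f g)
    have "space m = space M" "space a = space M" "space b = space M"
      using sets by (auto dest: sets_eq_imp_space_eq)
    then have "integral\<^sup>N m f = integral\<^sup>N m g" "integral\<^sup>N a f = integral\<^sup>N a g"
      "integral\<^sup>N b f = integral\<^sup>N b g"
      using cong(3) by (auto intro!: nn_integral_cong)
    then show ?case using cong(4) by simp
  next
    case (set A)
    then show ?case using sets eq by simp
  next
    case (mult u c)
    then show ?case
      using sets by (simp add: nn_integral_cmult distrib_left)
  next
    case (add u v)
    then show ?case
      using sets by (simp add: nn_integral_add ac_simps)
  next
    case (seq U)
    have meas: "\<And>i. U i \<in> borel_measurable m" "\<And>i. U i \<in> borel_measurable a" "\<And>i. U i \<in> borel_measurable b"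
      using seq(1) by simp_all
    have inc: "incseq (\<lambda>i. integral\<^sup>N a (U i))" "incseq (\<lambda>i. integral\<^sup>N b (U i))"
      using seq(3) by (auto intro!: incseq_SucI nn_integral_mono simp: incseq_Suc_iff le_fun_def)
    have "(SUP i. integral\<^sup>N a (U i) + integral\<^sup>N b (U i))
        = (SUP i. integral\<^sup>N a (U i)) + (SUP i. integral\<^sup>N b (U i))"
      using inc by (intro ennreal_SUP_add)
    then show ?case
      using seq meas by (simp add: nn_integral_monotone_convergence_SUP image_comp)
  qed
qed

text \<open>
  Keeping the difference as a measure with a formula for all integrals replaces calculations with
  signed measures in the coupling.
\<close>

lemma subtract_minorant:
  assumes sets: "sets m = sets M" "sets \<nu> = sets M"
    and fin: "emeasure m (space M) < \<infinity>" 
    and le: "\<And>A. A \<in> sets M \<Longrightarrow> k * emeasure \<nu> A \<le> emeasure m A"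
  obtains a where "sets a = sets M"
    "\<And>f. f \<in> borel_measurable M \<Longrightarrow> (\<integral>\<^sup>+x. f x \<partial>m) = (\<integral>\<^sup>+x. f x \<partial>a) + k * (\<integral>\<^sup>+x. f x \<partial>\<nu>)"
proof
  have sp: "space m = space M" "space \<nu> = space M"
    using sets by (auto dest: sets_eq_imp_space_eq)
  have finm: "finite_measure m"
    using fin sp by (intro finite_measureI) auto
  have "emeasure (scale_measure k \<nu>) (space M) \<le> emeasure m (space M)"
    using le[of "space M"] by simp
  then have fin\<nu>: "finite_measure (scale_measure k \<nu>)"
    using fin sp by (intro finite_measureI) (auto simp: space_scale_measure top_unique)
  let ?a = "diff_measure m (scale_measure k \<nu>)"
  show [simp]: "sets ?a = sets M" using sets by simp
  have em: "emeasure ?a A = emeasure m A - k * emeasure \<nu> A" if "A \<in> sets M" for A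
    using emeasure_diff_measure[OF finm fin\<nu>, of A] le that sets by simp
  fix f :: "'a \<Rightarrow> ennreal" assume f: "f \<in> borel_measurable M"
  have "(\<integral>\<^sup>+x. f x \<partial>m) = (\<integral>\<^sup>+x. f x \<partial>?a) + (\<integral>\<^sup>+x. f x \<partial>scale_measure k \<nu>)"
    using f em le sets by (intro nn_integral_eq_add_measures[of _ M]) (auto simp: diff_add_cancel_ennreal)
  then show "(\<integral>\<^sup>+x. f x \<partial>m) = (\<integral>\<^sup>+x. f x \<partial>?a) + k * (\<integral>\<^sup>+x. f x \<partial>\<nu>)"
    using f sets by (simp add: nn_integral_scale_measure cong: measurable_cong_sets)
qed

section \<open>Scaled sub-Markov kernels\<close>

text \<open>
  The factor \<open>r\<close> is the inverse of the eigenvalue \<open>\<theta>0\<close>. It is kept apart from the kernel because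
  \<open>r * P x\<close> may have mass above \<open>1\<close> and is then not an element of \<open>subprob_algebra M\<close>.
\<close>

locale scaled_kernel =
  fixes M :: "'a measure" and P :: "'a \<Rightarrow> 'a measure" and r :: ennreal
  assumes kernel[measurable]: "P \<in> measurable M (subprob_algebra M)"
    and r: "0 < r" "r < \<infinity>"
begin

definition Q :: "('a \<Rightarrow> ennreal) \<Rightarrow> 'a \<Rightarrow> ennreal" where
  "Q f x = r * (\<integral>\<^sup>+y. f y \<partial>P x)"

definition push :: "'a measure \<Rightarrow> 'a measure" where
  "push a = scale_measure r (a \<bind> P)"

lemma sets_kernel [simp]: "x \<in> space M \<Longrightarrow> sets (P x) = sets M"
  using measurable_space[OF kernel] by (simp add: space_subprob_algebra)

lemma space_kernel [simp]: "x \<in> space M \<Longrightarrow> space (P x) = space M"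
  by (rule sets_eq_imp_space_eq) simp

lemma measurable_kernel [simp]: "x \<in> space M \<Longrightarrow> borel_measurable (P x) = borel_measurable M"
  by (rule measurable_cong_sets) auto

lemma Q_measurable [measurable (raw)]:
  assumes [measurable]: "f \<in> borel_measurable M"
  shows "Q f \<in> borel_measurable M"
proof -
  have "(\<lambda>x. \<integral>\<^sup>+y. f y \<partial>P x) \<in> borel_measurable M"
    by (rule nn_integral_measurable_subprob_algebra2[where N = M]) measurable
  then show ?thesis unfolding Q_def[abs_def] by measurable
qed

lemma Q_pow_measurable [measurable (raw)]:
  "f \<in> borel_measurable M \<Longrightarrow> (Q ^^ n) f \<in> borel_measurable M"
  by (induction n) auto

lemma Q_mono:
  "(\<And>y. y \<in> space M \<Longrightarrow> f y \<le> g y) \<Longrightarrow> x \<in> space M \<Longrightarrow> Q f x \<le> Q g x"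
  unfolding Q_def by (intro mult_left_mono nn_integral_mono) auto

lemma Q_pow_mono:
  "(\<And>y. y \<in> space M \<Longrightarrow> f y \<le> g y) \<Longrightarrow> x \<in> space M \<Longrightarrow> (Q ^^ n) f x \<le> (Q ^^ n) g x"
  by (induction n arbitrary: x) (auto intro: Q_mono)

lemma Q_pow_cong:
  "(\<And>y. y \<in> space M \<Longrightarrow> f y = g y) \<Longrightarrow> x \<in> space M \<Longrightarrow> (Q ^^ n) f x = (Q ^^ n) g x"
  by (intro antisym Q_pow_mono) auto

lemma Q_add:
  assumes "f \<in> borel_measurable M" "g \<in> borel_measurable M" "x \<in> space M"
  shows "Q (\<lambda>y. f y + g y) x = Q f x + Q g x"
  using assms by (simp add: Q_def nn_integral_add distrib_left)

lemma Q_cmult: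
  assumes "f \<in> borel_measurable M" "x \<in> space M"
  shows "Q (\<lambda>y. c * f y) x = c * Q f x"
  using assms by (simp add: Q_def nn_integral_cmult ac_simps)

lemma Q_pow_add:
  assumes [measurable]: "f \<in> borel_measurable M" "g \<in> borel_measurable M" and "x \<in> space M"
  shows "(Q ^^ n) (\<lambda>y. f y + g y) x = (Q ^^ n) f x + (Q ^^ n) g x"
  using assms(3)
proof (induction n arbitrary: x)
  case (Suc n)
  have "(Q ^^ Suc n) (\<lambda>y. f y + g y) x = Q (\<lambda>y. (Q ^^ n) f y + (Q ^^ n) g y) x"
    using Q_pow_cong[of "(Q ^^ n) (\<lambda>y. f y + g y)" "\<lambda>y. (Q ^^ n) f y + (Q ^^ n) g y" x 1] Suc by simp
  then show ?case using Suc.prems by (simp add: Q_add)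
qed simp

lemma Q_pow_cmult:
  assumes [measurable]: "f \<in> borel_measurable M" and "x \<in> space M"
  shows "(Q ^^ n) (\<lambda>y. c * f y) x = c * (Q ^^ n) f x"
  using assms(2)
proof (induction n arbitrary: x)
  case (Suc n)
  have "(Q ^^ Suc n) (\<lambda>y. c * f y) x = Q (\<lambda>y. c * (Q ^^ n) f y) x"
    using Q_pow_cong[of "(Q ^^ n) (\<lambda>y. c * f y)" "\<lambda>y. c * (Q ^^ n) f y" x 1] Suc by simp
  then show ?case using Suc.prems by (simp add: Q_cmult)
qed simp

lemma Q_sum:
  assumes "finite J" "\<And>j. j \<in> J \<Longrightarrow> f j \<in> borel_measurable M" "x \<in> space M"
  shows "Q (\<lambda>y. \<Sum>j\<in>J. f j y) x = (\<Sum>j\<in>J. Q (f j) x)"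
  using assms
proof (induction J rule: finite_induct)
  case empty
  then show ?case by (simp add: Q_def)
next
  case (insert j J)
  then show ?case
    using Q_add[of "f j" "\<lambda>y. \<Sum>j\<in>J. f j y" x] by simp
qed

lemma sets_push:
  assumes "sets a = sets M" "space M \<noteq> {}"
  shows "sets (push a) = sets M"
proof -
  have "space a = space M" using assms(1) by (rule sets_eq_imp_space_eq)
  then have "sets (a \<bind> P) = sets M" using assms(2) by (intro sets_bind) auto
  then show ?thesis by (simp add: push_def)
qed

lemma push_pow_sets: "sets a = sets M \<Longrightarrow> space M \<noteq> {} \<Longrightarrow> sets ((push ^^ n) a) = sets M"
  by (induction n) (auto simp: sets_push)

lemma nn_integral_push:
  assumes "sets a = sets M" "space M \<noteq> {}" "f \<in> borel_measurable M"
  shows "(\<integral>\<^sup>+x. f x \<partial>push a) = (\<integral>\<^sup>+x. Q f x \<partial>a)"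
proof -
  have sp: "space a = space M" using assms(1) by (rule sets_eq_imp_space_eq)
  have P: "P \<in> measurable a (subprob_algebra M)"
    using kernel assms(1) by (simp cong: measurable_cong_sets)
  have "sets (a \<bind> P) = sets M" using sp assms(2) by (intro sets_bind) auto
  then have "(\<integral>\<^sup>+x. f x \<partial>push a) = r * (\<integral>\<^sup>+x. \<integral>\<^sup>+y. f y \<partial>P x \<partial>a)"
    using assms(3) unfolding push_def
    by (subst nn_integral_scale_measure) (auto simp: nn_integral_bind[OF assms(3) P] cong: measurable_cong_sets)
  also have "\<dots> = (\<integral>\<^sup>+x. Q f x \<partial>a)"
    unfolding Q_def
    by (rule nn_integral_cmult[symmetric], rule nn_integral_measurable_subprob_algebra2[where N = M])
       (use assms(3) P in measurable)
  finally show ?thesis .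
qed

lemma nn_integral_push_pow:
  assumes a: "sets a = sets M" "space M \<noteq> {}" and f[measurable]: "f \<in> borel_measurable M"
  shows "(\<integral>\<^sup>+x. f x \<partial>(push ^^ n) a) = (\<integral>\<^sup>+x. (Q ^^ n) f x \<partial>a)"
  using f
proof (induction n arbitrary: f)
  case (Suc n)
  have "(\<integral>\<^sup>+x. f x \<partial>(push ^^ Suc n) a) = (\<integral>\<^sup>+x. Q f x \<partial>(push ^^ n) a)"
    using Suc.prems nn_integral_push[OF push_pow_sets[OF a] a(2)] by simp
  also have "\<dots> = (\<integral>\<^sup>+x. (Q ^^ Suc n) f x \<partial>a)"
    using Suc by (simp add: funpow_swap1)
  finally show ?case .
qed simp

text \<open>
  Whether \<open>Q f x\<close> is positive depends only on the set where \<open>f\<close> is positive.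
\<close>

lemma Q_pos_mono:
  assumes f: "f \<in> borel_measurable M" and g: "g \<in> borel_measurable M"
    and le: "\<And>y. y \<in> space M \<Longrightarrow> 0 < f y \<Longrightarrow> 0 < g y" and x: "x \<in> space M" and pos: "0 < Q f x"
  shows "0 < Q g x"
proof (rule ccontr)
  assume "\<not> 0 < Q g x"
  then have "(\<integral>\<^sup>+y. g y \<partial>P x) = 0" using r by (auto simp: Q_def)
  then have "AE y in P x. g y = 0" using g x by (subst (asm) nn_integral_0_iff_AE) auto
  then have "AE y in P x. f y = 0"
    using AE_space by eventually_elim (use le x in \<open>force simp: zero_less_iff_neq_zero\<close>)
  then have "(\<integral>\<^sup>+y. f y \<partial>P x) = 0" using f x by (subst nn_integral_0_iff_AE) auto
  with pos show False by (simp add: Q_def)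
qed

lemma Q_pow_pos_mono:
  assumes [measurable]: "f \<in> borel_measurable M" "g \<in> borel_measurable M"
    and le: "\<And>y. y \<in> space M \<Longrightarrow> 0 < f y \<Longrightarrow> 0 < g y" and x: "x \<in> space M" and pos: "0 < (Q ^^ n) f x"
  shows "0 < (Q ^^ n) g x"
  using x pos
proof (induction n arbitrary: x)
  case (Suc n)
  then show ?case by (auto intro: Q_pos_mono[of "(Q ^^ n) f"])
qed (use le in auto)

end

section \<open>Lyapunov functions and the limit eigenfunction\<close>

lemma ennreal_power_bound_imp_0:
  fixes t s :: ennreal
  assumes "\<And>n. t \<le> ennreal (q ^ n) * s" "0 \<le> q" "q < 1" "s < \<infinity>"
  shows "t = 0"
proof -
  have "(\<lambda>n. ennreal (q ^ n)) \<longlonglongrightarrow> ennreal 0"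
    using assms by (intro tendsto_ennrealI LIMSEQ_realpow_zero) auto
  then have "(\<lambda>n. s * ennreal (q ^ n)) \<longlonglongrightarrow> s * 0"
    using assms by (intro ennreal_tendsto_cmult) auto
  then have "t \<le> s * 0"
    using assms(1) by (intro LIMSEQ_le_const) (auto simp: mult.commute)
  then show ?thesis by simp
qed

text \<open>
  An abstract form of Assumption (E) for the kernel divided by its eigenvalue: \<open>\<alpha>\<close> is an eigenmeasure
  with eigenvalue \<open>1\<close>, and \<open>doeblin\<close>, \<open>harnack\<close> and \<open>aperiodic\<close> correspond to (E1), (E3) and (E4). Only
  one Lyapunov function \<open>\<phi>\<close> appears, so that the powers of \<open>\<phi>1\<close> give further instances. What the
  lower Lyapunov function contributes is contained in \<open>\<gamma> < 1\<close>.
\<close>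

locale lyapunov_kernel = scaled_kernel M P r
  for M :: "'a measure" and P :: "'a \<Rightarrow> 'a measure" and r :: ennreal +
  fixes \<phi> \<eta> :: "'a \<Rightarrow> ennreal" and K :: "'a set" and \<alpha> \<nu> :: "'a measure"
    and \<gamma> C c c3 :: real and n1 :: nat
  assumes phi_measurable [measurable]: "\<phi> \<in> borel_measurable M"
    and phi_ge_1: "\<And>x. x \<in> space M \<Longrightarrow> 1 \<le> \<phi> x"
    and phi_finite: "\<And>x. x \<in> space M \<Longrightarrow> \<phi> x < \<infinity>"
    and K [measurable]: "K \<in> sets M"
    and gamma: "0 \<le> \<gamma>" "\<gamma> < 1" and C: "0 \<le> C"
    and drift: "\<And>x. x \<in> space M \<Longrightarrow> Q \<phi> x \<le> ennreal \<gamma> * \<phi> x + ennreal C * indicator K x"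
    and nu: "sets \<nu> = sets M" "emeasure \<nu> (space M) = 1" "AE x in \<nu>. x \<in> K"
    and c: "0 < c"
    and doeblin: "\<And>x f. x \<in> K \<Longrightarrow> f \<in> borel_measurable M \<Longrightarrow>
      ennreal c * (\<integral>\<^sup>+y. f y \<partial>\<nu>) \<le> (Q ^^ n1) f x"
    and c3: "0 < c3"
    and harnack: "\<And>n x y. x \<in> K \<Longrightarrow> y \<in> K \<Longrightarrow> (Q ^^ n) (\<lambda>_. 1) x \<le> ennreal c3 * (Q ^^ n) (\<lambda>_. 1) y"
    and aperiodic: "\<And>x. x \<in> K \<Longrightarrow> \<exists>m. \<forall>n\<ge>m. 0 < (Q ^^ n) (indicator K) x"
    and alpha: "sets \<alpha> = sets M" "emeasure \<alpha> (space M) = 1" "(\<integral>\<^sup>+x. \<phi> x \<partial>\<alpha>) < \<infinity>"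
    and alpha_Q: "\<And>f. f \<in> borel_measurable M \<Longrightarrow> (\<integral>\<^sup>+x. Q f x \<partial>\<alpha>) = (\<integral>\<^sup>+x. f x \<partial>\<alpha>)"
    and eta: "\<And>x. x \<in> space M \<Longrightarrow> (\<lambda>n. (Q ^^ n) (\<lambda>_. 1) x) \<longlonglongrightarrow> \<eta> x"
begin

abbreviation u :: "nat \<Rightarrow> 'a \<Rightarrow> ennreal" where
  "u n \<equiv> (Q ^^ n) (\<lambda>_. 1)"

lemma measurable_alpha [simp]: "borel_measurable \<alpha> = borel_measurable M"
  using alpha(1) by (rule measurable_cong_sets) simp

lemma measurable_nu [simp]: "borel_measurable \<nu> = borel_measurable M"
  using nu(1) by (rule measurable_cong_sets) simp

lemma space_alpha [simp]: "space \<alpha> = space M"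
  using alpha(1) by (rule sets_eq_imp_space_eq)

lemma space_nu [simp]: "space \<nu> = space M"
  using nu(1) by (rule sets_eq_imp_space_eq)

lemma K_space: "x \<in> K \<Longrightarrow> x \<in> space M"
  using sets.sets_into_space[OF K] by auto

lemma space_nonempty: "space M \<noteq> {}"
  using alpha(2) by auto

lemma eta_measurable [measurable]: "\<eta> \<in> borel_measurable M"
  by (rule borel_measurable_LIMSEQ_order[OF eta]) auto

lemma alpha_Q_pow: "f \<in> borel_measurable M \<Longrightarrow> (\<integral>\<^sup>+x. (Q ^^ n) f x \<partial>\<alpha>) = (\<integral>\<^sup>+x. f x \<partial>\<alpha>)"
  by (induction n) (auto simp: alpha_Q)

text \<open>
  Were \<open>K\<close> negligible, invariance of \<open>\<alpha>\<close> and the drift would give \<open>\<alpha>(\<phi>) \<le> \<gamma> \<alpha>(\<phi>)\<close> with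
  \<open>1 \<le> \<alpha>(\<phi>) < \<infinity>\<close>.
\<close>

lemma alpha_K_pos: "0 < emeasure \<alpha> K"
proof (rule ccontr)
  assume "\<not> ?thesis"
  then have 0: "emeasure \<alpha> K = 0" by simp
  obtain t where t: "(\<integral>\<^sup>+x. \<phi> x \<partial>\<alpha>) = ennreal t" "0 \<le> t"
    using alpha(3) by (cases "\<integral>\<^sup>+x. \<phi> x \<partial>\<alpha>") auto
  have "(\<integral>\<^sup>+x. 1 \<partial>\<alpha>) \<le> (\<integral>\<^sup>+x. \<phi> x \<partial>\<alpha>)"
    using phi_ge_1 by (intro nn_integral_mono) auto
  then have "1 \<le> t" using alpha(2) t by simp
  have "(\<integral>\<^sup>+x. \<phi> x \<partial>\<alpha>) = (\<integral>\<^sup>+x. Q \<phi> x \<partial>\<alpha>)" by (simp add: alpha_Q)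
  also have "\<dots> \<le> (\<integral>\<^sup>+x. ennreal \<gamma> * \<phi> x + ennreal C * indicator K x \<partial>\<alpha>)"
    using drift by (intro nn_integral_mono) auto
  also have "\<dots> = ennreal \<gamma> * ennreal t"
    using 0 t alpha(1) by (simp add: nn_integral_add nn_integral_cmult)
  finally have "t \<le> \<gamma> * t"
    using t gamma by (simp flip: ennreal_mult)
  with \<open>1 \<le> t\<close> gamma show False
    by (smt (verit, best) mult_le_cancel_right1)
qed

text \<open>
  By the Harnack inequality \<open>u n x * \<alpha>(K) \<le> c3 * \<alpha>(u n)\<close> for \<open>x\<close> in \<open>K\<close>, and \<open>\<alpha>(u n) = 1\<close>.
\<close>

lemma u_bounded_on_K: obtains M0 :: real where "0 \<le> M0" "\<And>n x. x \<in> K \<Longrightarrow> u n x \<le> ennreal M0"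
proof -
  obtain k where k: "emeasure \<alpha> K = ennreal k" "0 < k"
  proof (cases "emeasure \<alpha> K")
    case top
    have "emeasure \<alpha> K \<le> emeasure \<alpha> (space M)" using alpha(1) K by (intro emeasure_mono) (auto dest: K_space)
    then show ?thesis using top alpha(2) by (simp add: top_unique)
  qed (use alpha_K_pos that in auto)
  have "u n x \<le> ennreal (c3 / k)" if x: "x \<in> K" for n x
  proof -
    have "u n x * ennreal k = (\<integral>\<^sup>+y. u n x * indicator K y \<partial>\<alpha>)"
      using alpha(1) k by (simp add: nn_integral_cmult)
    also have "\<dots> \<le> (\<integral>\<^sup>+y. ennreal c3 * u n y \<partial>\<alpha>)"
      using harnack[OF x] by (intro nn_integral_mono) (auto split: split_indicator)
    also have "\<dots> = ennreal c3"
      using alpha(2) by (simp add: nn_integral_cmult alpha_Q_pow)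
    finally have "u n x * ennreal k \<le> ennreal c3" .
    then show ?thesis
      using k c3 by (cases "u n x") (auto simp: field_simps top_unique ennreal_mult_eq_top_iff simp flip: ennreal_mult)
  qed
  then show ?thesis using that[of "c3 / k"] k c3 by auto
qed

text \<open>
  Induction on \<open>n\<close>: on \<open>K\<close> the bound is \<open>u_bounded_on_K\<close>, and outside \<open>K\<close> one has
  \<open>Q \<phi> \<le> \<gamma> \<phi> \<le> \<phi>\<close>. This domination is what makes limits under integrals legitimate everywhere below.
\<close>

lemma u_le_phi: obtains H :: real where "1 \<le> H" "\<And>n x. x \<in> space M \<Longrightarrow> u n x \<le> ennreal H * \<phi> x"
proof -
  obtain M0 where M0: "0 \<le> M0" "\<And>n x. x \<in> K \<Longrightarrow> u n x \<le> ennreal M0"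
    using u_bounded_on_K by blast
  define H where "H = max 1 M0"
  have "u n x \<le> ennreal H * \<phi> x" if "x \<in> space M" for n x
    using that
  proof (induction n arbitrary: x)
    case 0
    have "1 * 1 \<le> ennreal H * \<phi> x"
      using phi_ge_1[OF 0] by (intro mult_mono) (auto simp: H_def)
    then show ?case by simp
  next
    case (Suc n)
    show ?case
    proof (cases "x \<in> K")
      case True
      have "u (Suc n) x * 1 \<le> ennreal H * \<phi> x"
        using M0(2)[OF True, of "Suc n"] phi_ge_1[OF Suc.prems]
        by (intro mult_mono) (auto simp: H_def ennreal_leI intro: order_trans)
      then show ?thesis by simp
    next
      case False
      have "u (Suc n) x \<le> Q (\<lambda>y. ennreal H * \<phi> y) x"
        using Suc by (auto intro: Q_mono)
      also have "\<dots> \<le> ennreal H * (ennreal \<gamma> * \<phi> x)"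
        using drift[OF Suc.prems] Suc.prems False by (auto simp: Q_cmult intro!: mult_left_mono)
      also have "\<dots> \<le> ennreal H * (1 * \<phi> x)"
        using gamma by (intro mult_left_mono mult_right_mono) auto
      finally show ?thesis by simp
    qed
  qed
  then show ?thesis using that[of H] by (auto simp: H_def)
qed

lemma eta_le:
  assumes "\<And>n. u n x \<le> b" "x \<in> space M"
  shows "\<eta> x \<le> b"
  using eta[OF assms(2)] assms(1) by (intro LIMSEQ_le_const2) auto

text \<open>
  Iterating the drift; the factors \<open>\<gamma>\<^sup>i\<close> in front of the visits to \<open>K\<close> are estimated by \<open>1\<close>.
\<close>

lemma phi_iterate:
  "x \<in> space M \<Longrightarrow>
    (Q ^^ n) \<phi> x \<le> ennreal (\<gamma> ^ n) * \<phi> x + ennreal C * (\<Sum>j<n. (Q ^^ j) (indicator K) x)"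
proof (induction n arbitrary: x)
  case (Suc n)
  note x = Suc.prems
  have "(Q ^^ Suc n) \<phi> x
      \<le> Q (\<lambda>y. ennreal (\<gamma> ^ n) * \<phi> y + ennreal C * (\<Sum>j<n. (Q ^^ j) (indicator K) y)) x"
    using Suc by (auto intro: Q_mono)
  also have "\<dots> = ennreal (\<gamma> ^ n) * Q \<phi> x + ennreal C * (\<Sum>j<n. (Q ^^ Suc j) (indicator K) x)"
    using x by (simp add: Q_add Q_cmult Q_sum)
  also have "\<dots> \<le> ennreal (\<gamma> ^ n) * (ennreal \<gamma> * \<phi> x + ennreal C * indicator K x)
      + ennreal C * (\<Sum>j<n. (Q ^^ Suc j) (indicator K) x)"
    using drift[OF x] by (intro add_right_mono mult_left_mono) auto
  also have "\<dots> \<le> (ennreal (\<gamma> ^ Suc n) * \<phi> x + 1 * (ennreal C * indicator K x))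
      + ennreal C * (\<Sum>j<n. (Q ^^ Suc j) (indicator K) x)"
    using gamma unfolding distrib_left
    by (intro add_mono mult_right_mono) (auto simp: power_le_one ennreal_mult ac_simps)
  also have "\<dots> = ennreal (\<gamma> ^ Suc n) * \<phi> x + ennreal C * (\<Sum>j<Suc n. (Q ^^ j) (indicator K) x)"
    by (subst sum.lessThan_Suc_shift) (simp add: distrib_left ac_simps)
  finally show ?case .
qed simp

lemma phi_bounded: obtains B :: real where "0 \<le> B" "\<And>n x. x \<in> space M \<Longrightarrow> (Q ^^ n) \<phi> x \<le> ennreal B * \<phi> x"
proof -
  obtain H where H: "1 \<le> H" "\<And>n x. x \<in> space M \<Longrightarrow> u n x \<le> ennreal H * \<phi> x"
    using u_le_phi by blast
  define B where "B = max 1 (C * H / (1 - \<gamma>))"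
  have B: "1 \<le> B" "\<gamma> * B + C * H \<le> B"
    using gamma by (auto simp: B_def field_simps max_def)
  have "(Q ^^ n) \<phi> x \<le> ennreal B * \<phi> x" if "x \<in> space M" for n x
    using that
  proof (induction n)
    case 0
    have "1 * \<phi> x \<le> ennreal B * \<phi> x" using B by (intro mult_right_mono) auto
    then show ?case by simp
  next
    case (Suc n)
    have "(Q ^^ Suc n) \<phi> x \<le> (Q ^^ n) (\<lambda>y. ennreal \<gamma> * \<phi> y + ennreal C * indicator K y) x"
      unfolding funpow_Suc_right comp_def using drift Suc.prems by (intro Q_pow_mono) auto
    also have "\<dots> = ennreal \<gamma> * (Q ^^ n) \<phi> x + ennreal C * (Q ^^ n) (indicator K) x"
      using Suc.prems by (simp add: Q_pow_add Q_pow_cmult)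
    also have "\<dots> \<le> ennreal \<gamma> * (ennreal B * \<phi> x) + ennreal C * (ennreal H * \<phi> x)"
    proof (intro add_mono mult_left_mono)
      have "(Q ^^ n) (indicator K) x \<le> u n x"
        using Suc.prems by (intro Q_pow_mono) (auto split: split_indicator)
      with H(2) Suc.prems show "(Q ^^ n) (indicator K) x \<le> ennreal H * \<phi> x"
        by (blast intro: order_trans)
    qed (use Suc in auto)
    also have "\<dots> = ennreal (\<gamma> * B + C * H) * \<phi> x"
      using gamma B C H by (simp add: ennreal_mult algebra_simps)
    also have "\<dots> \<le> ennreal B * \<phi> x"
      using B by (intro mult_right_mono ennreal_leI) auto
    finally show ?case .
  qed
  then show ?thesis using that[of B] B by auto
qed

lemma integral_le_phi:
  assumes a: "sets a = sets M" "(\<integral>\<^sup>+x. \<phi> x \<partial>a) < \<infinity>"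
    and f: "\<And>x. x \<in> space M \<Longrightarrow> f x \<le> ennreal H * \<phi> x"
  shows "(\<integral>\<^sup>+x. f x \<partial>a) \<le> ennreal H * (\<integral>\<^sup>+x. \<phi> x \<partial>a)" "(\<integral>\<^sup>+x. f x \<partial>a) < \<infinity>"
proof -
  have "space a = space M" using a(1) by (rule sets_eq_imp_space_eq)
  then have "(\<integral>\<^sup>+x. f x \<partial>a) \<le> (\<integral>\<^sup>+x. ennreal H * \<phi> x \<partial>a)"
    using f by (intro nn_integral_mono) auto
  also have "\<dots> = ennreal H * (\<integral>\<^sup>+x. \<phi> x \<partial>a)"
    using a by (intro nn_integral_cmult) (simp cong: measurable_cong_sets)
  finally show *: "(\<integral>\<^sup>+x. f x \<partial>a) \<le> ennreal H * (\<integral>\<^sup>+x. \<phi> x \<partial>a)" .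
  also have "\<dots> < \<infinity>" using a by (simp add: ennreal_mult_less_top)
  finally show "(\<integral>\<^sup>+x. f x \<partial>a) < \<infinity>" .
qed

lemma integral_u_tendsto:
  assumes a: "sets a = sets M" "(\<integral>\<^sup>+x. \<phi> x \<partial>a) < \<infinity>"
  shows "(\<lambda>n. \<integral>\<^sup>+x. u n x \<partial>a) \<longlonglongrightarrow> (\<integral>\<^sup>+x. \<eta> x \<partial>a)" "(\<integral>\<^sup>+x. \<eta> x \<partial>a) < \<infinity>"
proof -
  obtain H where H: "1 \<le> H" "\<And>n x. x \<in> space M \<Longrightarrow> u n x \<le> ennreal H * \<phi> x"
    using u_le_phi by blast
  have sp: "space a = space M" using a(1) by (rule sets_eq_imp_space_eq)
  have mb [simp]: "borel_measurable a = borel_measurable M"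
    using a(1) by (rule measurable_cong_sets) simp
  show "(\<lambda>n. \<integral>\<^sup>+x. u n x \<partial>a) \<longlonglongrightarrow> (\<integral>\<^sup>+x. \<eta> x \<partial>a)"
  proof (rule nn_integral_dominated_convergence[where w = "\<lambda>x. ennreal H * \<phi> x"])
    show "(\<integral>\<^sup>+x. ennreal H * \<phi> x \<partial>a) < \<infinity>"
      using a(2) by (simp add: nn_integral_cmult ennreal_mult_less_top)
  qed (use H eta sp in auto)
  show "(\<integral>\<^sup>+x. \<eta> x \<partial>a) < \<infinity>"
    using H eta_le by (intro integral_le_phi(2)[OF a, of _ H]) auto
qed

lemma Q_eta:
  assumes x: "x \<in> space M"
  shows "Q \<eta> x = \<eta> x"
proof -
  have "Q \<phi> x < \<infinity>"
    using phi_finite[OF x]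
    by (intro le_less_trans[OF drift[OF x]]) (auto simp: ennreal_mult_less_top split: split_indicator)
  then have "r * (\<integral>\<^sup>+y. \<phi> y \<partial>P x) < \<infinity>" by (simp add: Q_def)
  then have "(\<integral>\<^sup>+y. \<phi> y \<partial>P x) < \<infinity>"
    using r by (auto simp: ennreal_mult_less_top)
  then have "(\<lambda>n. r * (\<integral>\<^sup>+y. u n y \<partial>P x)) \<longlonglongrightarrow> r * (\<integral>\<^sup>+y. \<eta> y \<partial>P x)"
    using r x integral_u_tendsto[of "P x"] by (intro ennreal_tendsto_cmult) auto
  then have "(\<lambda>n. u (Suc n) x) \<longlonglongrightarrow> Q \<eta> x"
    by (simp add: Q_def)
  with eta[OF x] show ?thesis
    using LIMSEQ_unique LIMSEQ_Suc by blast
qed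

lemma Q_pow_eta: "x \<in> space M \<Longrightarrow> (Q ^^ n) \<eta> x = \<eta> x"
proof (induction n arbitrary: x)
  case (Suc n)
  have "(Q ^^ Suc n) \<eta> x = Q \<eta> x"
    using Suc Q_pow_cong[of "(Q ^^ n) \<eta>" \<eta> x 1] by simp
  then show ?case using Suc.prems by (simp add: Q_eta)
qed simp

lemma alpha_eta: "(\<integral>\<^sup>+x. \<eta> x \<partial>\<alpha>) = 1"
proof -
  have "(\<lambda>n. \<integral>\<^sup>+x. u n x \<partial>\<alpha>) = (\<lambda>n. 1)"
    using alpha(2) by (simp add: alpha_Q_pow)
  with integral_u_tendsto(1)[OF alpha(1,3)] show ?thesis
    by (simp add: LIMSEQ_const_iff)
qed

text \<open>
  If \<open>\<eta>\<close> vanished at one point of \<open>K\<close>, it would vanish on all of \<open>K\<close> by the Harnack inequality.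
  Then \<open>\<eta> = Q \<eta>\<close> loses a factor \<open>\<gamma>\<close> relative to \<open>\<phi>\<close> in each step off \<open>K\<close>, so \<open>\<eta> = 0\<close>, contradicting
  \<open>\<alpha>(\<eta>) = 1\<close>.
\<close>

lemma eta_pos_on_K:
  assumes x: "x \<in> K"
  shows "0 < \<eta> x"
proof (rule ccontr)
  assume "\<not> 0 < \<eta> x"
  then have x0: "\<eta> x = 0" by simp
  have K0: "\<eta> y = 0" if y: "y \<in> K" for y
  proof -
    have "(\<lambda>n. ennreal c3 * u n x) \<longlonglongrightarrow> ennreal c3 * \<eta> x"
      using x by (intro ennreal_tendsto_cmult eta K_space) auto
    then have "\<eta> y \<le> ennreal c3 * \<eta> x"
      using harnack[OF y x] eta[OF K_space[OF y]] by (intro LIMSEQ_le) auto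
    with x0 show ?thesis by simp
  qed
  obtain H where H: "1 \<le> H" "\<And>n x. x \<in> space M \<Longrightarrow> u n x \<le> ennreal H * \<phi> x"
    using u_le_phi by blast
  have bound: "\<eta> y \<le> ennreal (\<gamma> ^ n) * (ennreal H * \<phi> y)" if "y \<in> space M" for n y
    using that
  proof (induction n arbitrary: y)
    case 0
    then show ?case using eta_le H by simp
  next
    case (Suc n)
    show ?case
    proof (cases "y \<in> K")
      case False
      have "\<eta> y = Q \<eta> y" using Q_eta Suc.prems by simp
      also have "\<dots> \<le> Q (\<lambda>z. ennreal (\<gamma> ^ n * H) * \<phi> z) y"
        using Suc gamma H(1) by (intro Q_mono) (auto simp: ennreal_mult ac_simps)
      also have "\<dots> = ennreal (\<gamma> ^ n * H) * Q \<phi> y"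
        using Suc.prems by (simp add: Q_cmult)
      also have "\<dots> \<le> ennreal (\<gamma> ^ n * H) * (ennreal \<gamma> * \<phi> y)"
        using drift[OF Suc.prems] False by (intro mult_left_mono) auto
      also have "\<dots> = ennreal (\<gamma> ^ Suc n) * (ennreal H * \<phi> y)"
        using gamma H(1) by (simp add: ennreal_mult ac_simps)
      finally show ?thesis .
    qed (simp add: K0)
  qed
  have "\<eta> y = 0" if "y \<in> space M" for y
    using bound[OF that] gamma phi_finite[OF that]
    by (intro ennreal_power_bound_imp_0[of _ \<gamma> "ennreal H * \<phi> y"]) (auto simp: ennreal_mult_less_top)
  then have "(\<integral>\<^sup>+x. \<eta> x \<partial>\<alpha>) = (\<integral>\<^sup>+x. 0 \<partial>\<alpha>)"
    by (intro nn_integral_cong) auto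
  with alpha_eta show False by simp
qed

text \<open>
  A starting point that never reaches \<open>K\<close> has \<open>Q\<^sup>n \<phi> \<le> \<gamma>\<^sup>n \<phi>\<close>, so no function dominated by
  \<open>\<phi>\<close> can grow there by a factor \<open>\<rho> > \<gamma>\<close> in each step. The lemma serves both for \<open>\<eta>\<close>
  (with \<open>\<rho> = 1\<close>) and for the lower Lyapunov function.
\<close>

lemma hits_K:
  assumes \<psi> [measurable]: "\<psi> \<in> borel_measurable M" and le: "\<And>y. y \<in> space M \<Longrightarrow> \<psi> y \<le> ennreal H * \<phi> y"
    and expand: "\<And>y. y \<in> space M \<Longrightarrow> ennreal \<rho> * \<psi> y \<le> Q \<psi> y" and \<rho>: "\<gamma> < \<rho>"
    and x: "x \<in> space M" and pos: "0 < \<psi> x"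
  shows "\<exists>j. 0 < (Q ^^ j) (indicator K) x"
proof (rule ccontr)
  assume "\<not> ?thesis"
  then have 0: "(Q ^^ j) (indicator K) x = 0" for j by simp
  have \<rho>0: "0 < \<rho>" using gamma \<rho> by simp
  have grow: "ennreal (\<rho> ^ n) * \<psi> x \<le> (Q ^^ n) \<psi> x" for n
  proof (induction n)
    case (Suc n)
    have "ennreal (\<rho> ^ Suc n) * \<psi> x = ennreal \<rho> * (ennreal (\<rho> ^ n) * \<psi> x)"
      using \<rho>0 by (simp add: ennreal_mult ac_simps)
    also have "\<dots> \<le> ennreal \<rho> * (Q ^^ n) \<psi> x"
      using Suc by (intro mult_left_mono) auto
    also have "\<dots> = (Q ^^ n) (\<lambda>y. ennreal \<rho> * \<psi> y) x"
      using x by (simp add: Q_pow_cmult)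
    also have "\<dots> \<le> (Q ^^ n) (Q \<psi>) x"
      using expand x by (intro Q_pow_mono) auto
    finally show ?case by (simp add: funpow_swap1)
  qed simp
  have "\<psi> x \<le> ennreal ((\<gamma> / \<rho>) ^ n) * (ennreal H * \<phi> x)" for n
  proof -
    have "(Q ^^ n) \<psi> x \<le> (Q ^^ n) (\<lambda>y. ennreal H * \<phi> y) x"
      using le x by (intro Q_pow_mono) auto
    also have "\<dots> \<le> ennreal H * (ennreal (\<gamma> ^ n) * \<phi> x)"
      using phi_iterate[OF x, of n] x 0 by (auto simp: Q_pow_cmult intro!: mult_left_mono)
    finally have "ennreal (\<rho> ^ n) * \<psi> x \<le> ennreal H * (ennreal (\<gamma> ^ n) * \<phi> x)"
      using grow[of n] by (rule order_trans[rotated])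
    then have "ennreal (1 / \<rho> ^ n) * (ennreal (\<rho> ^ n) * \<psi> x)
        \<le> ennreal (1 / \<rho> ^ n) * (ennreal H * (ennreal (\<gamma> ^ n) * \<phi> x))"
      by (intro mult_left_mono) auto
    also have "ennreal (1 / \<rho> ^ n) * (ennreal (\<rho> ^ n) * \<psi> x) = \<psi> x"
      using \<rho>0 by (simp flip: mult.assoc ennreal_mult)
    also have "ennreal (1 / \<rho> ^ n) * (ennreal H * (ennreal (\<gamma> ^ n) * \<phi> x))
        = (ennreal (1 / \<rho> ^ n) * ennreal (\<gamma> ^ n)) * (ennreal H * \<phi> x)"
      by (simp add: ac_simps)
    also have "ennreal (1 / \<rho> ^ n) * ennreal (\<gamma> ^ n) = ennreal ((\<gamma> / \<rho>) ^ n)"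
      using \<rho>0 gamma by (simp add: power_divide flip: ennreal_mult)
    finally show ?thesis .
  qed
  then have "\<psi> x = 0"
    using gamma \<rho> \<rho>0 phi_finite[OF x]
    by (intro ennreal_power_bound_imp_0[of _ "\<gamma> / \<rho>" "ennreal H * \<phi> x"]) (auto simp: ennreal_mult_less_top)
  with pos show False by simp
qed

lemma eta_pos_if_hits_K:
  assumes x: "x \<in> space M" and "0 < (Q ^^ j) (indicator K) x"
  shows "0 < \<eta> x"
proof -
  have "0 < (Q ^^ j) \<eta> x"
    using assms eta_pos_on_K
    by (intro Q_pow_pos_mono[of "indicator K" \<eta> x j]) (auto split: split_indicator_asm)
  then show ?thesis using Q_pow_eta[OF x] by simp
qed

text \<open>
  Both sides say that \<open>K\<close> can be reached from \<open>x\<close>: positive functions on \<open>K\<close> are carried back to \<open>x\<close>, and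
  \<open>hits_K\<close> gives the converse. The right-hand side is first reduced to the points where \<open>\<psi>\<close> is
  positive.
\<close>

lemma eta_pos_iff:
  assumes \<psi> [measurable]: "\<psi> \<in> borel_measurable M" and le: "\<And>y. y \<in> space M \<Longrightarrow> \<psi> y \<le> 1"
    and K_pos: "\<And>y. y \<in> K \<Longrightarrow> 0 < \<psi> y"
    and expand: "\<And>y. y \<in> space M \<Longrightarrow> ennreal \<rho> * \<psi> y \<le> Q \<psi> y" and \<rho>: "\<gamma> < \<rho>" "\<rho> \<le> 1"
    and x: "x \<in> space M"
  shows "0 < \<eta> x \<longleftrightarrow> (\<exists>k. 0 < (Q ^^ k) \<psi> x)"
proof
  obtain H where H: "1 \<le> H" "\<And>n x. x \<in> space M \<Longrightarrow> u n x \<le> ennreal H * \<phi> x"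
    using u_le_phi by blast
  assume "0 < \<eta> x"
  obtain j where "0 < (Q ^^ j) (indicator K) x"
    using hits_K[OF eta_measurable eta_le _ gamma(2) x \<open>0 < \<eta> x\<close>, of H] H Q_eta by auto
  then have "0 < (Q ^^ j) \<psi> x"
    using x K_pos by (intro Q_pow_pos_mono[of "indicator K" \<psi> x j]) (auto split: split_indicator_asm)
  then show "\<exists>k. 0 < (Q ^^ k) \<psi> x" ..
next
  assume "\<exists>k. 0 < (Q ^^ k) \<psi> x"
  then obtain k where k: "0 < (Q ^^ k) \<psi> x" ..
  have "0 < \<eta> y" if y: "y \<in> space M" "0 < \<psi> y" for y
    using hits_K[OF \<psi> _ expand \<rho>(1) y, of 1] le phi_ge_1 eta_pos_if_hits_K[OF y(1)]
    by (force intro: order_trans)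
  then have "0 < (Q ^^ k) \<eta> x"
    using k x by (intro Q_pow_pos_mono[of \<psi> \<eta> x k]) auto
  then show "0 < \<eta> x" using Q_pow_eta[OF x] by simp
qed

section \<open>Minorization and coupling\<close>

lemma nu_eta: obtains v :: real where "0 < v" "(\<integral>\<^sup>+x. \<eta> x \<partial>\<nu>) = ennreal v"
proof -
  obtain M0 where M0: "0 \<le> M0" "\<And>n x. x \<in> K \<Longrightarrow> u n x \<le> ennreal M0"
    using u_bounded_on_K by blast
  have "(\<integral>\<^sup>+x. \<eta> x \<partial>\<nu>) \<le> (\<integral>\<^sup>+x. ennreal M0 \<partial>\<nu>)"
    using nu(3) by (intro nn_integral_mono_AE, eventually_elim) (use M0 eta_le K_space in blast)
  also have "\<dots> < \<infinity>" using nu(2) by simp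
  finally have fin: "(\<integral>\<^sup>+x. \<eta> x \<partial>\<nu>) < \<infinity>" .
  moreover have "(\<integral>\<^sup>+x. \<eta> x \<partial>\<nu>) \<noteq> 0"
  proof
    assume "(\<integral>\<^sup>+x. \<eta> x \<partial>\<nu>) = 0"
    then have "AE x in \<nu>. \<eta> x = 0" by (subst (asm) nn_integral_0_iff_AE) auto
    with nu(3) have "AE x in \<nu>. False"
      by eventually_elim (use eta_pos_on_K in force)
    then have "emeasure \<nu> (space \<nu>) = 0" by (subst (asm) AE_iff_measurable[of "space \<nu>"]) (auto simp: nu(1))
    with nu(2) show False by simp
  qed
  ultimately show ?thesis using that by (cases "\<integral>\<^sup>+x. \<eta> x \<partial>\<nu>") (auto simp: less_le)
qed

text \<open>
  Aperiodicity holds pointwise on \<open>K\<close> with a time depending on the point. Some level set of this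
  time has positive \<open>\<nu>\<close>-measure, which gives one time after which \<open>\<nu> Q\<^sup>n\<close> always charges \<open>K\<close>; a
  further application of \<open>doeblin\<close> returns a multiple of \<open>\<nu>\<close> itself.
\<close>

lemma nu_returns:
  obtains m0 where "\<And>m. m0 \<le> m \<Longrightarrow>
    \<exists>q>0. \<forall>f\<in>borel_measurable M. ennreal q * (\<integral>\<^sup>+x. f x \<partial>\<nu>) \<le> (\<integral>\<^sup>+x. (Q ^^ m) f x \<partial>\<nu>)"
proof -
  define B where "B k = {x \<in> space M. x \<in> K \<and> (\<forall>n\<ge>k. 0 < (Q ^^ n) (indicator K) x)}" for k
  have B [measurable]: "B k \<in> sets M" for k unfolding B_def by measurable
  have "\<exists>k. emeasure \<nu> (B k) \<noteq> 0"
  proof (rule ccontr)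
    assume "\<not> ?thesis"
    then have "(\<Union>k. B k) \<in> null_sets \<nu>"
      using nu(1) by (intro null_sets_UN) auto
    then have "AE x in \<nu>. x \<notin> (\<Union>k. B k)" by (rule AE_not_in)
    with nu(3) have "AE x in \<nu>. False"
    proof eventually_elim
      case (elim x)
      then show ?case using aperiodic[of x] K_space[of x] by (auto simp: B_def)
    qed
    then have "emeasure \<nu> (space \<nu>) = 0" by (subst (asm) AE_iff_measurable[of "space \<nu>"]) (auto simp: nu(1))
    with nu(2) show False by simp
  qed
  then obtain k where k: "emeasure \<nu> (B k) \<noteq> 0" ..
  have pos: "(\<integral>\<^sup>+x. (Q ^^ n) (indicator K) x \<partial>\<nu>) \<noteq> 0" if "k \<le> n" for n
  proof
    assume "(\<integral>\<^sup>+x. (Q ^^ n) (indicator K) x \<partial>\<nu>) = 0"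
    then have "AE x in \<nu>. (Q ^^ n) (indicator K) x = 0" by (subst (asm) nn_integral_0_iff_AE) auto
    then have "AE x in \<nu>. x \<notin> B k"
      by eventually_elim (use that in \<open>auto simp: B_def\<close>)
    then have "emeasure \<nu> (B k) = 0"
      using nu(1) sets.sets_into_space[OF B[of k]] by (subst (asm) AE_iff_measurable[of "B k"]) auto
    with k show False by simp
  qed
  have "\<exists>q>0. \<forall>f\<in>borel_measurable M. ennreal q * (\<integral>\<^sup>+x. f x \<partial>\<nu>) \<le> (\<integral>\<^sup>+x. (Q ^^ m) f x \<partial>\<nu>)"
    if m: "k + n1 \<le> m" for m
  proof -
    define n where "n = m - n1"
    have n: "k \<le> n" "m = n + n1" using m by (auto simp: n_def)
    define t where "t = (\<integral>\<^sup>+x. (Q ^^ n) (indicator K) x \<partial>\<nu>)"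
    obtain q where q: "0 < q" "ennreal q \<le> ennreal c * t"
    proof (cases t)
      case (real t')
      then show ?thesis using that[of "c * t'"] pos[OF n(1)] c by (auto simp: t_def ennreal_mult less_le)
    next
      case top
      then show ?thesis using that[of 1] c by (auto simp: ennreal_mult_top)
    qed
    have "ennreal q * (\<integral>\<^sup>+x. f x \<partial>\<nu>) \<le> (\<integral>\<^sup>+x. (Q ^^ m) f x \<partial>\<nu>)"
      if f [measurable]: "f \<in> borel_measurable M" for f
    proof -
      define I where "I = (\<integral>\<^sup>+x. f x \<partial>\<nu>)"
      have "ennreal q * I \<le> (ennreal c * I) * t"
        using mult_right_mono[OF q(2), of I] by (simp add: ac_simps)
      also have "\<dots> = (\<integral>\<^sup>+x. (ennreal c * I) * (Q ^^ n) (indicator K) x \<partial>\<nu>)"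
        by (simp add: t_def nn_integral_cmult)
      also have "\<dots> = (\<integral>\<^sup>+x. (Q ^^ n) (\<lambda>y. (ennreal c * I) * indicator K y) x \<partial>\<nu>)"
        by (intro nn_integral_cong) (simp add: Q_pow_cmult)
      also have "\<dots> \<le> (\<integral>\<^sup>+x. (Q ^^ n) ((Q ^^ n1) f) x \<partial>\<nu>)"
        using doeblin[OF _ f] by (intro nn_integral_mono Q_pow_mono) (auto simp: I_def split: split_indicator)
      finally show ?thesis by (simp add: I_def n(2) funpow_add)
    qed
    with q show ?thesis by blast
  qed
  then show ?thesis using that[of "k + n1"] by blast
qed

text \<open>
  If no \<open>a Q\<^sup>j\<close> with \<open>j < J\<close> charged \<open>K\<close> by a fixed fraction of \<open>a(\<eta>)\<close>, the iterated drift would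
  make \<open>a Q\<^sup>J\<close> so small on \<open>\<phi>\<close>, hence on \<open>\<eta>\<close>, that the conservation law \<open>a(Q\<^sup>J \<eta>) = a(\<eta>)\<close> fails.
\<close>

lemma visit_K:
  assumes R: "0 < R"
  obtains J e where "0 < e" "\<And>a. \<lbrakk>sets a = sets M; (\<integral>\<^sup>+x. \<eta> x \<partial>a) < \<infinity>; (\<integral>\<^sup>+x. \<eta> x \<partial>a) > 0;
      (\<integral>\<^sup>+x. \<phi> x \<partial>a) \<le> ennreal R * (\<integral>\<^sup>+x. \<eta> x \<partial>a)\<rbrakk> \<Longrightarrow>
    \<exists>j<J. ennreal e * (\<integral>\<^sup>+x. \<eta> x \<partial>a) \<le> (\<integral>\<^sup>+x. (Q ^^ j) (indicator K) x \<partial>a)"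
proof -
  obtain H where H: "1 \<le> H" "\<And>n x. x \<in> space M \<Longrightarrow> u n x \<le> ennreal H * \<phi> x"
    using u_le_phi by blast
  have "(\<lambda>J. H * R * \<gamma> ^ J) \<longlonglongrightarrow> H * R * 0"
    using gamma by (intro tendsto_intros LIMSEQ_realpow_zero) auto
  then have "eventually (\<lambda>J. H * R * \<gamma> ^ J < 1 / 2) sequentially"
    by (intro order_tendstoD) auto
  then obtain J where J: "H * R * \<gamma> ^ J < 1 / 2" by (auto simp: eventually_sequentially)
  (* With this e, the J visits to K contribute at most half of the eta-mass after the
     comparison of eta with H * phi; J was chosen so that the decayed initial term
     contributes less than the other half. *)
  define Z where "Z = H * (C + 1) * (J + 1)"
  have Z: "0 < Z" using H C by (simp add: Z_def)
  define e where "e = 1 / (2 * Z)"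
  have e: "0 < e" using Z by (simp add: e_def)
  have "H * C * J * e \<le> Z * e"
    unfolding Z_def using H C e by (intro mult_right_mono mult_mono) auto
  also have "\<dots> = 1 / 2"
    using Z by (simp add: e_def)
  finally have He: "H * C * J * e \<le> 1 / 2" .
  show ?thesis
  proof (rule that[OF e, of J], rule ccontr)
    fix a assume a: "sets a = sets M" "(\<integral>\<^sup>+x. \<eta> x \<partial>a) < \<infinity>" "(\<integral>\<^sup>+x. \<eta> x \<partial>a) > 0"
      "(\<integral>\<^sup>+x. \<phi> x \<partial>a) \<le> ennreal R * (\<integral>\<^sup>+x. \<eta> x \<partial>a)"
    assume no: "\<not> (\<exists>j<J. ennreal e * (\<integral>\<^sup>+x. \<eta> x \<partial>a) \<le> (\<integral>\<^sup>+x. (Q ^^ j) (indicator K) x \<partial>a))"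
    have [simp]: "space a = space M" using a(1) by (rule sets_eq_imp_space_eq)
    have [simp]: "borel_measurable a = borel_measurable M"
      using a(1) by (rule measurable_cong_sets) simp
    obtain D where D: "(\<integral>\<^sup>+x. \<eta> x \<partial>a) = ennreal D" "0 < D"
      using a(2,3) by (cases "\<integral>\<^sup>+x. \<eta> x \<partial>a") auto
    have "ennreal D = (\<integral>\<^sup>+x. (Q ^^ J) \<eta> x \<partial>a)"
      unfolding D(1)[symmetric] by (intro nn_integral_cong) (simp add: Q_pow_eta)
    also have "\<dots> \<le> (\<integral>\<^sup>+x. ennreal H * (ennreal (\<gamma> ^ J) * \<phi> x
        + ennreal C * (\<Sum>j<J. (Q ^^ j) (indicator K) x)) \<partial>a)"
    proof (intro nn_integral_mono)
      fix x assume x: "x \<in> space a"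
      have "(Q ^^ J) \<eta> x \<le> (Q ^^ J) (\<lambda>y. ennreal H * \<phi> y) x"
        using x H eta_le by (intro Q_pow_mono) auto
      also have "\<dots> = ennreal H * (Q ^^ J) \<phi> x" using x by (simp add: Q_pow_cmult)
      also have "\<dots> \<le> ennreal H * (ennreal (\<gamma> ^ J) * \<phi> x + ennreal C * (\<Sum>j<J. (Q ^^ j) (indicator K) x))"
        using x by (intro mult_left_mono phi_iterate) auto
      finally show "(Q ^^ J) \<eta> x \<le> \<dots>" .
    qed
    also have "\<dots> = ennreal H * (ennreal (\<gamma> ^ J) * (\<integral>\<^sup>+x. \<phi> x \<partial>a)
        + ennreal C * (\<Sum>j<J. \<integral>\<^sup>+x. (Q ^^ j) (indicator K) x \<partial>a))"
      by (simp add: nn_integral_cmult nn_integral_add nn_integral_sum)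
    also have "\<dots> \<le> ennreal H * (ennreal (\<gamma> ^ J) * (ennreal R * ennreal D)
        + ennreal C * (\<Sum>j<J. ennreal e * ennreal D))"
      using a(4) no unfolding D by (intro mult_left_mono add_mono sum_mono) (auto simp: not_le)
    also have "\<dots> = ennreal ((H * R * \<gamma> ^ J + H * C * J * e) * D)"
      using H gamma R C e D
      by (simp add: ennreal_mult ennreal_of_nat_eq_real_of_nat algebra_simps)
    finally have "D \<le> (H * R * \<gamma> ^ J + H * C * J * e) * D"
      using D H gamma R C e by (subst (asm) ennreal_le_iff) auto
    moreover have "(H * R * \<gamma> ^ J + H * C * J * e) * D < 1 * D"
      using J He D by (intro mult_strict_right_mono) auto
    ultimately show False by simp
  qed
qed

text \<open>
  The time \<open>j\<close> at which \<open>K\<close> is visited depends on the measure \<open>a\<close>. It is compensated by the waiting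
  time \<open>m0 + (J - j)\<close> that follows the minorization: over this finite range of times \<open>nu_returns\<close>
  provides a common constant, so that \<open>N\<close> and \<open>d\<close> depend on \<open>R\<close> only.
\<close>

lemma minorization:
  assumes R: "0 < R"
  obtains N d where "0 < d" "\<And>a f. \<lbrakk>sets a = sets M; (\<integral>\<^sup>+x. \<eta> x \<partial>a) < \<infinity>;
      (\<integral>\<^sup>+x. \<phi> x \<partial>a) \<le> ennreal R * (\<integral>\<^sup>+x. \<eta> x \<partial>a); f \<in> borel_measurable M\<rbrakk> \<Longrightarrow>
    ennreal d * (\<integral>\<^sup>+x. \<eta> x \<partial>a) * (\<integral>\<^sup>+x. f x \<partial>\<nu>) \<le> (\<integral>\<^sup>+x. (Q ^^ N) f x \<partial>a)"
proof -
  obtain J e where e: "0 < e" and visit: "\<And>a. \<lbrakk>sets a = sets M; (\<integral>\<^sup>+x. \<eta> x \<partial>a) < \<infinity>; (\<integral>\<^sup>+x. \<eta> x \<partial>a) > 0;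
      (\<integral>\<^sup>+x. \<phi> x \<partial>a) \<le> ennreal R * (\<integral>\<^sup>+x. \<eta> x \<partial>a)\<rbrakk> \<Longrightarrow>
    \<exists>j<J. ennreal e * (\<integral>\<^sup>+x. \<eta> x \<partial>a) \<le> (\<integral>\<^sup>+x. (Q ^^ j) (indicator K) x \<partial>a)"
    using visit_K[OF R] by metis
  obtain m0 where "\<And>m. m0 \<le> m \<Longrightarrow>
    \<exists>q>0. \<forall>f\<in>borel_measurable M. ennreal q * (\<integral>\<^sup>+x. f x \<partial>\<nu>) \<le> (\<integral>\<^sup>+x. (Q ^^ m) f x \<partial>\<nu>)"
    using nu_returns by blast
  then obtain q :: "nat \<Rightarrow> real" where q: "\<And>m. m0 \<le> m \<Longrightarrow> 0 < q m"
    "\<And>m f. m0 \<le> m \<Longrightarrow> f \<in> borel_measurable M \<Longrightarrow>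
      ennreal (q m) * (\<integral>\<^sup>+x. f x \<partial>\<nu>) \<le> (\<integral>\<^sup>+x. (Q ^^ m) f x \<partial>\<nu>)"
    by metis
  define q0 where "q0 = Min (q ` {m0..m0 + J})"
  have q0: "0 < q0" "\<And>m. m0 \<le> m \<Longrightarrow> m \<le> m0 + J \<Longrightarrow> q0 \<le> q m"
    using q(1) by (auto simp: q0_def)
  define N where "N = J + n1 + m0"
  define d where "d = e * c * q0"
  have d: "0 < d" using e c q0 by (simp add: d_def)
  show ?thesis
  proof (rule that[OF d, of N])
    fix a and f :: "'a \<Rightarrow> ennreal" assume a: "sets a = sets M" "(\<integral>\<^sup>+x. \<eta> x \<partial>a) < \<infinity>"
      "(\<integral>\<^sup>+x. \<phi> x \<partial>a) \<le> ennreal R * (\<integral>\<^sup>+x. \<eta> x \<partial>a)" and f [measurable]: "f \<in> borel_measurable M"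
    have [simp]: "space a = space M" using a(1) by (rule sets_eq_imp_space_eq)
    have [simp]: "borel_measurable a = borel_measurable M"
      using a(1) by (rule measurable_cong_sets) simp
    define D where "D = (\<integral>\<^sup>+x. \<eta> x \<partial>a)"
    define I where "I = (\<integral>\<^sup>+x. f x \<partial>\<nu>)"
    show "ennreal d * (\<integral>\<^sup>+x. \<eta> x \<partial>a) * (\<integral>\<^sup>+x. f x \<partial>\<nu>) \<le> (\<integral>\<^sup>+x. (Q ^^ N) f x \<partial>a)"
    proof (cases "D = 0")
      case False
      then obtain j where j: "j < J" "ennreal e * D \<le> (\<integral>\<^sup>+x. (Q ^^ j) (indicator K) x \<partial>a)"
        using visit[OF a(1,2) _ a(3)] by (auto simp: D_def zero_less_iff_neq_zero)
      define m where "m = m0 + (J - j)"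
      have N: "N = j + (n1 + m)" using j by (simp add: N_def m_def)
      have "q0 \<le> q m" by (intro q0) (auto simp: m_def)
      then have "ennreal q0 * I \<le> ennreal (q m) * I"
        by (intro mult_right_mono ennreal_leI) auto
      also have "\<dots> \<le> (\<integral>\<^sup>+x. (Q ^^ m) f x \<partial>\<nu>)"
        unfolding I_def by (intro q(2)) (auto simp: m_def)
      finally have I: "ennreal q0 * I \<le> (\<integral>\<^sup>+x. (Q ^^ m) f x \<partial>\<nu>)" .
      have "ennreal d * D * I = ennreal c * (ennreal q0 * I) * (ennreal e * D)"
        using e c q0 by (simp add: d_def ennreal_mult ac_simps)
      also have "\<dots> \<le> ennreal c * (\<integral>\<^sup>+x. (Q ^^ m) f x \<partial>\<nu>) * (\<integral>\<^sup>+x. (Q ^^ j) (indicator K) x \<partial>a)"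
        using j(2) I by (intro mult_mono) auto
      also have "\<dots> = (\<integral>\<^sup>+x. ennreal c * (\<integral>\<^sup>+x. (Q ^^ m) f x \<partial>\<nu>) * (Q ^^ j) (indicator K) x \<partial>a)"
        by (simp add: nn_integral_cmult)
      also have "\<dots> = (\<integral>\<^sup>+x. (Q ^^ j) (\<lambda>y. ennreal c * (\<integral>\<^sup>+x. (Q ^^ m) f x \<partial>\<nu>) * indicator K y) x \<partial>a)"
        by (intro nn_integral_cong) (simp add: Q_pow_cmult)
      also have "\<dots> \<le> (\<integral>\<^sup>+x. (Q ^^ j) ((Q ^^ n1) ((Q ^^ m) f)) x \<partial>a)"
        using doeblin[of _ "(Q ^^ m) f"] by (intro nn_integral_mono Q_pow_mono) (auto split: split_indicator)
      finally show ?thesis by (simp add: N funpow_add D_def I_def)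
    qed (simp add: D_def[symmetric])
  qed
qed

text \<open>
  One step of the coupling. As \<open>\<eta>\<close> is invariant, taking \<open>d D \<nu>\<close> out of \<open>a Q\<^sup>N\<close> reduces the
  \<open>\<eta>\<close>-mass from \<open>D\<close> to exactly \<open>(1 - d v) D\<close>; two measures of equal \<open>\<eta>\<close>-mass thus keep this
  property.
\<close>

lemma remove_common_part:
  assumes a: "sets a = sets M" "(\<integral>\<^sup>+x. \<phi> x \<partial>a) < \<infinity>" "(\<integral>\<^sup>+x. \<eta> x \<partial>a) = ennreal D"
    and D: "0 \<le> D" and d: "0 \<le> d" and v: "0 \<le> v" "(\<integral>\<^sup>+x. \<eta> x \<partial>\<nu>) = ennreal v"
    and minor: "\<And>f. f \<in> borel_measurable M \<Longrightarrow>
      ennreal (d * D) * (\<integral>\<^sup>+x. f x \<partial>\<nu>) \<le> (\<integral>\<^sup>+x. (Q ^^ N) f x \<partial>a)"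
  obtains a' where "sets a' = sets M"
    "\<And>f. f \<in> borel_measurable M \<Longrightarrow>
      (\<integral>\<^sup>+x. (Q ^^ N) f x \<partial>a) = (\<integral>\<^sup>+x. f x \<partial>a') + ennreal (d * D) * (\<integral>\<^sup>+x. f x \<partial>\<nu>)"
    "(\<integral>\<^sup>+x. \<eta> x \<partial>a') = ennreal ((1 - d * v) * D)"
proof -
  obtain H where H: "1 \<le> H" "\<And>n x. x \<in> space M \<Longrightarrow> u n x \<le> ennreal H * \<phi> x"
    using u_le_phi by blast
  have sp [simp]: "space a = space M" using a(1) by (rule sets_eq_imp_space_eq)
  let ?m = "(push ^^ N) a"
  have sets: "sets ?m = sets M" by (rule push_pow_sets[OF a(1) space_nonempty])
  have integral_m: "(\<integral>\<^sup>+x. f x \<partial>?m) = (\<integral>\<^sup>+x. (Q ^^ N) f x \<partial>a)" if "f \<in> borel_measurable M" for f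
    using a(1) space_nonempty that by (rule nn_integral_push_pow)
  have em: "emeasure ?m A = (\<integral>\<^sup>+x. (Q ^^ N) (indicator A) x \<partial>a)" if "A \<in> sets M" for A
    using integral_m[of "indicator A"] that sets by simp
  have "emeasure ?m (space M) = (\<integral>\<^sup>+x. u N x \<partial>a)"
    unfolding em[OF sets.top] by (intro nn_integral_cong Q_pow_cong) auto
  also have "\<dots> < \<infinity>" using integral_le_phi(2)[OF a(1,2) H(2)] by simp
  finally have fin: "emeasure ?m (space M) < \<infinity>" .
  have le: "ennreal (d * D) * emeasure \<nu> A \<le> emeasure ?m A" if "A \<in> sets M" for A
    using minor[of "indicator A"] em[OF that] that nu(1) by simp
  obtain a' where a': "sets a' = sets M"
    "\<And>f. f \<in> borel_measurable M \<Longrightarrow> (\<integral>\<^sup>+x. f x \<partial>?m) = (\<integral>\<^sup>+x. f x \<partial>a') + ennreal (d * D) * (\<integral>\<^sup>+x. f x \<partial>\<nu>)"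
    using subtract_minorant[OF sets nu(1) fin le] by blast
  have "ennreal D = (\<integral>\<^sup>+x. (Q ^^ N) \<eta> x \<partial>a)"
    unfolding a(3)[symmetric] by (intro nn_integral_cong) (simp add: Q_pow_eta)
  also have "\<dots> = (\<integral>\<^sup>+x. \<eta> x \<partial>a') + ennreal (d * D * v)"
    using a'(2)[of \<eta>] integral_m[of \<eta>] v D d by (simp add: ennreal_mult)
  finally have eq: "(\<integral>\<^sup>+x. \<eta> x \<partial>a') + ennreal (d * D * v) = ennreal D" by simp
  have "(\<integral>\<^sup>+x. \<eta> x \<partial>a') = ennreal ((1 - d * v) * D)"
  proof (cases "\<integral>\<^sup>+x. \<eta> x \<partial>a'")
    case (real t)
    have "t + d * D * v = D"
      using eq real D d v(1) by (simp flip: ennreal_plus)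
    then show ?thesis using real by (simp add: algebra_simps)
  qed (use eq in simp)
  with a' integral_m show ?thesis using that by simp
qed

text \<open>
  The functional \<open>\<rho>\<close> is integration against the coupled part, and it cancels when the two
  identities are compared. The minorization needs a bound on
  the ratio of \<open>\<phi>\<close>-mass to \<open>\<eta>\<close>-mass. The \<open>\<phi>\<close>-mass of the remainders stays below a constant \<open>L\<close>, so as
  long as the \<open>\<eta>\<close>-mass exceeds \<open>\<epsilon>\<close> the constants for \<open>R = L / \<epsilon>\<close> apply and the \<open>\<eta>\<close>-mass decreases
  geometrically.
\<close>

lemma coupling:
  assumes a0: "sets a0 = sets M" "(\<integral>\<^sup>+x. \<phi> x \<partial>a0) < \<infinity>"
    and b0: "sets b0 = sets M" "(\<integral>\<^sup>+x. \<phi> x \<partial>b0) < \<infinity>"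
    and eq: "(\<integral>\<^sup>+x. \<eta> x \<partial>a0) = (\<integral>\<^sup>+x. \<eta> x \<partial>b0)" and \<epsilon>: "0 < (\<epsilon>::real)"
  obtains n a b \<rho> where "sets a = sets M" "sets b = sets M"
    "\<And>f. f \<in> borel_measurable M \<Longrightarrow> (\<integral>\<^sup>+x. (Q ^^ n) f x \<partial>a0) = (\<integral>\<^sup>+x. f x \<partial>a) + \<rho> f"
    "\<And>f. f \<in> borel_measurable M \<Longrightarrow> (\<integral>\<^sup>+x. (Q ^^ n) f x \<partial>b0) = (\<integral>\<^sup>+x. f x \<partial>b) + \<rho> f"
    "(\<integral>\<^sup>+x. \<phi> x \<partial>a) < \<infinity>" "(\<integral>\<^sup>+x. \<phi> x \<partial>b) < \<infinity>"
    "(\<integral>\<^sup>+x. \<eta> x \<partial>a) \<le> ennreal \<epsilon>" "(\<integral>\<^sup>+x. \<eta> x \<partial>b) \<le> ennreal \<epsilon>"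
proof -
  obtain B where B: "0 \<le> B" "\<And>n x. x \<in> space M \<Longrightarrow> (Q ^^ n) \<phi> x \<le> ennreal B * \<phi> x"
    using phi_bounded by blast
  obtain sa sb where s: "(\<integral>\<^sup>+x. \<phi> x \<partial>a0) = ennreal sa" "0 \<le> sa" "(\<integral>\<^sup>+x. \<phi> x \<partial>b0) = ennreal sb" "0 \<le> sb"
    using a0(2) b0(2) by (metis ennreal_cases infinity_ennreal_def less_irrefl)
  define L where "L = B * (sa + sb) + 1"
  have "0 \<le> B * sa" "0 \<le> B * sb" using B s by auto
  then have L: "0 < L" "B * sa \<le> L" "B * sb \<le> L"
    by (auto simp: L_def distrib_left)
  have phi_a0: "(\<integral>\<^sup>+x. (Q ^^ n) \<phi> x \<partial>a0) \<le> ennreal L" for n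
  proof -
    have "(\<integral>\<^sup>+x. (Q ^^ n) \<phi> x \<partial>a0) \<le> ennreal B * ennreal sa"
      using integral_le_phi(1)[OF a0 B(2)[where n=n]] s by simp
    also have "\<dots> \<le> ennreal L" using L B s by (auto simp flip: ennreal_mult intro: ennreal_leI)
    finally show ?thesis .
  qed
  have phi_b0: "(\<integral>\<^sup>+x. (Q ^^ n) \<phi> x \<partial>b0) \<le> ennreal L" for n
  proof -
    have "(\<integral>\<^sup>+x. (Q ^^ n) \<phi> x \<partial>b0) \<le> ennreal B * ennreal sb"
      using integral_le_phi(1)[OF b0 B(2)[where n=n]] s by simp
    also have "\<dots> \<le> ennreal L" using L B s by (auto simp flip: ennreal_mult intro: ennreal_leI)
    finally show ?thesis .
  qed
  have add_le_imp_le: "s \<le> t" if "s + w \<le> t" for s t w :: ennreal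
    using that by (rule order_trans[rotated]) simp
  obtain D0 where D0: "(\<integral>\<^sup>+x. \<eta> x \<partial>a0) = ennreal D0" "0 \<le> D0"
    using integral_u_tendsto(2)[OF a0] by (metis ennreal_cases infinity_ennreal_def less_irrefl)
  obtain v where v: "0 < v" "(\<integral>\<^sup>+x. \<eta> x \<partial>\<nu>) = ennreal v" using nu_eta by blast
  define R where "R = L / \<epsilon>"
  have R: "0 < R" using L \<epsilon> by (simp add: R_def)
  obtain N d' where d': "0 < d'" and minor': "\<And>a f. \<lbrakk>sets a = sets M; (\<integral>\<^sup>+x. \<eta> x \<partial>a) < \<infinity>;
      (\<integral>\<^sup>+x. \<phi> x \<partial>a) \<le> ennreal R * (\<integral>\<^sup>+x. \<eta> x \<partial>a); f \<in> borel_measurable M\<rbrakk> \<Longrightarrow>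
    ennreal d' * (\<integral>\<^sup>+x. \<eta> x \<partial>a) * (\<integral>\<^sup>+x. f x \<partial>\<nu>) \<le> (\<integral>\<^sup>+x. (Q ^^ N) f x \<partial>a)"
    using minorization[OF R] by metis
  (* The minimum keeps the contraction factor 1 - d * v in the interval [1/2, 1). *)
  define d where "d = min d' (1 / (2 * v))"
  have d: "0 < d" "d \<le> d'" "d * v \<le> 1 / 2"
    using d' v by (auto simp: d_def field_simps min_def)
  have minor: "ennreal (d * D) * (\<integral>\<^sup>+x. f x \<partial>\<nu>) \<le> (\<integral>\<^sup>+x. (Q ^^ N) f x \<partial>a)"
    if "sets a = sets M" "(\<integral>\<^sup>+x. \<eta> x \<partial>a) = ennreal D" "\<epsilon> \<le> D" "(\<integral>\<^sup>+x. \<phi> x \<partial>a) \<le> ennreal L"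
      "f \<in> borel_measurable M" for a D f
  proof -
    have "L \<le> R * D" using that(3) L \<epsilon> by (simp add: R_def field_simps)
    then have "(\<integral>\<^sup>+x. \<phi> x \<partial>a) \<le> ennreal R * (\<integral>\<^sup>+x. \<eta> x \<partial>a)"
      using that(2,3,4) \<epsilon> R by (auto simp flip: ennreal_mult intro!: order_trans[OF that(4)] ennreal_leI)
    then have "ennreal d' * ennreal D * (\<integral>\<^sup>+x. f x \<partial>\<nu>) \<le> (\<integral>\<^sup>+x. (Q ^^ N) f x \<partial>a)"
      using minor'[of a f] that by simp
    moreover have "ennreal (d * D) * (\<integral>\<^sup>+x. f x \<partial>\<nu>) \<le> ennreal d' * ennreal D * (\<integral>\<^sup>+x. f x \<partial>\<nu>)"
      using d \<epsilon> that(3) by (intro mult_right_mono) (auto simp flip: ennreal_mult intro!: ennreal_leI mult_right_mono)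
    ultimately show ?thesis by (rule order_trans[rotated])
  qed
  define q where "q = 1 - d * v"
  have q: "0 \<le> q" "q < 1" using d v by (auto simp: q_def intro: mult_pos_pos)
  have "\<exists>n a b \<rho>. sets a = sets M \<and> sets b = sets M \<and>
    (\<forall>f\<in>borel_measurable M. (\<integral>\<^sup>+x. (Q ^^ n) f x \<partial>a0) = (\<integral>\<^sup>+x. f x \<partial>a) + \<rho> f) \<and>
    (\<forall>f\<in>borel_measurable M. (\<integral>\<^sup>+x. (Q ^^ n) f x \<partial>b0) = (\<integral>\<^sup>+x. f x \<partial>b) + \<rho> f) \<and>
    (\<integral>\<^sup>+x. \<eta> x \<partial>a) = (\<integral>\<^sup>+x. \<eta> x \<partial>b) \<and>
    (\<integral>\<^sup>+x. \<eta> x \<partial>a) \<le> ennreal (max \<epsilon> (q ^ j * D0))" for j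
  proof (induction j)
    case 0
    show ?case
      using a0 b0 eq[symmetric] D0
      by - (rule exI[of _ 0], rule exI[of _ a0], rule exI[of _ b0], rule exI[of _ "\<lambda>_. 0"],
          auto intro!: ennreal_leI)
  next
    case (Suc j)
    then obtain n a b \<rho> where ab: "sets a = sets M" "sets b = sets M"
      "\<And>f. f \<in> borel_measurable M \<Longrightarrow> (\<integral>\<^sup>+x. (Q ^^ n) f x \<partial>a0) = (\<integral>\<^sup>+x. f x \<partial>a) + \<rho> f"
      "\<And>f. f \<in> borel_measurable M \<Longrightarrow> (\<integral>\<^sup>+x. (Q ^^ n) f x \<partial>b0) = (\<integral>\<^sup>+x. f x \<partial>b) + \<rho> f"
      "(\<integral>\<^sup>+x. \<eta> x \<partial>a) = (\<integral>\<^sup>+x. \<eta> x \<partial>b)" "(\<integral>\<^sup>+x. \<eta> x \<partial>a) \<le> ennreal (max \<epsilon> (q ^ j * D0))"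
      by blast
    obtain D where D: "(\<integral>\<^sup>+x. \<eta> x \<partial>a) = ennreal D" "0 \<le> D" "D \<le> max \<epsilon> (q ^ j * D0)"
      using ab(6) q \<epsilon> by (cases "\<integral>\<^sup>+x. \<eta> x \<partial>a") (auto simp: top_unique le_max_iff_disj max_def)
    show ?case
    proof (cases "D \<le> \<epsilon>")
      case True
      then have "(\<integral>\<^sup>+x. \<eta> x \<partial>a) \<le> ennreal (max \<epsilon> (q ^ Suc j * D0))"
        unfolding D(1) by (intro ennreal_leI) simp
      then show ?thesis
        using ab(1-5)
        by - (rule exI[of _ n], rule exI[of _ a], rule exI[of _ b], rule exI[of _ \<rho>], auto)
    next
      case False
      have phi: "(\<integral>\<^sup>+x. \<phi> x \<partial>a) \<le> ennreal L" "(\<integral>\<^sup>+x. \<phi> x \<partial>b) \<le> ennreal L"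
        using phi_a0[of n] phi_b0[of n] ab(3,4)[of \<phi>] by (auto elim: add_le_imp_le)
      then have phi': "(\<integral>\<^sup>+x. \<phi> x \<partial>a) < \<infinity>" "(\<integral>\<^sup>+x. \<phi> x \<partial>b) < \<infinity>"
        by (auto intro: le_less_trans)
      have Db: "(\<integral>\<^sup>+x. \<eta> x \<partial>b) = ennreal D" using D ab by simp
      note [simp] = less_imp_le[OF d(1)] less_imp_le[OF v(1)]
      have "\<epsilon> \<le> D" using False by simp
      obtain a' where a': "sets a' = sets M"
        "\<And>f. f \<in> borel_measurable M \<Longrightarrow>
          (\<integral>\<^sup>+x. (Q ^^ N) f x \<partial>a) = (\<integral>\<^sup>+x. f x \<partial>a') + ennreal (d * D) * (\<integral>\<^sup>+x. f x \<partial>\<nu>)"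
        "(\<integral>\<^sup>+x. \<eta> x \<partial>a') = ennreal (q * D)"
        using remove_common_part[OF ab(1) phi'(1) D(1,2) _ _ v(2) minor[OF ab(1) D(1) \<open>\<epsilon> \<le> D\<close> phi(1)]]
        by (auto simp: q_def)
      obtain b' where b': "sets b' = sets M"
        "\<And>f. f \<in> borel_measurable M \<Longrightarrow>
          (\<integral>\<^sup>+x. (Q ^^ N) f x \<partial>b) = (\<integral>\<^sup>+x. f x \<partial>b') + ennreal (d * D) * (\<integral>\<^sup>+x. f x \<partial>\<nu>)"
        "(\<integral>\<^sup>+x. \<eta> x \<partial>b') = ennreal (q * D)"
        using remove_common_part[OF ab(2) phi'(2) Db D(2) _ _ v(2) minor[OF ab(2) Db \<open>\<epsilon> \<le> D\<close> phi(2)]]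
        by (auto simp: q_def)
      have "q * D \<le> q ^ Suc j * D0"
        using D(3) False q by (auto simp: max_def mult_left_mono mult.assoc split: if_splits)
      then show ?thesis
        using a' b' ab(3)[of "(Q ^^ N) _"] ab(4)[of "(Q ^^ N) _"]
        by - (rule exI[of _ "n + N"], rule exI[of _ a'], rule exI[of _ b'],
            rule exI[of _ "\<lambda>f. ennreal (d * D) * (\<integral>\<^sup>+x. f x \<partial>\<nu>) + \<rho> ((Q ^^ N) f)"],
            auto simp: funpow_add add.assoc intro!: ennreal_leI)
    qed
  qed
  note iterate = this
  have "(\<lambda>j. q ^ j * D0) \<longlonglongrightarrow> 0 * D0"
    using q by (intro tendsto_intros LIMSEQ_realpow_zero) auto
  then have "eventually (\<lambda>j. q ^ j * D0 < \<epsilon>) sequentially"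
    using \<epsilon> by (intro order_tendstoD) auto
  then obtain j where j: "q ^ j * D0 < \<epsilon>" by (auto simp: eventually_sequentially)
  then have "max \<epsilon> (q ^ j * D0) = \<epsilon>" by simp
  with iterate[of j] obtain n a b \<rho> where ab: "sets a = sets M" "sets b = sets M"
    "\<And>f. f \<in> borel_measurable M \<Longrightarrow> (\<integral>\<^sup>+x. (Q ^^ n) f x \<partial>a0) = (\<integral>\<^sup>+x. f x \<partial>a) + \<rho> f"
    "\<And>f. f \<in> borel_measurable M \<Longrightarrow> (\<integral>\<^sup>+x. (Q ^^ n) f x \<partial>b0) = (\<integral>\<^sup>+x. f x \<partial>b) + \<rho> f"
    "(\<integral>\<^sup>+x. \<eta> x \<partial>a) = (\<integral>\<^sup>+x. \<eta> x \<partial>b)" "(\<integral>\<^sup>+x. \<eta> x \<partial>a) \<le> ennreal \<epsilon>"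
    by metis
  have "(\<integral>\<^sup>+x. \<phi> x \<partial>a) \<le> ennreal L" "(\<integral>\<^sup>+x. \<phi> x \<partial>b) \<le> ennreal L"
    using phi_a0[of n] phi_b0[of n] ab(3,4)[of \<phi>] by (auto elim: add_le_imp_le)
  then have "(\<integral>\<^sup>+x. \<phi> x \<partial>a) < \<infinity>" "(\<integral>\<^sup>+x. \<phi> x \<partial>b) < \<infinity>"
    by (auto intro: le_less_trans)
  then show ?thesis using that[of a b n \<rho>] ab by simp
qed

text \<open>
  In the language of signed measures: \<open>\<mu> Q\<^sup>n - \<mu>(\<eta>) \<alpha> = a - b\<close> with two positive measures of total
  mass at most \<open>\<epsilon>\<close>. The coupling controls only the \<open>\<eta>\<close>-mass of the remainders, which says nothing
  where \<open>\<eta> = 0\<close>. Running the remainders for \<open>k\<close> further steps turns their total mass into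
  \<open>a(u k)\<close> and \<open>b(u k)\<close>, and these tend to the \<open>\<eta>\<close>-masses.
\<close>

theorem convergence_to_alpha:
  assumes \<mu>: "sets \<mu> = sets M" "(\<integral>\<^sup>+x. \<phi> x \<partial>\<mu>) < \<infinity>" and \<epsilon>: "0 < (\<epsilon>::real)"
  obtains n0 where "\<And>n. n0 \<le> n \<Longrightarrow> \<exists>a b. sets a = sets M \<and> sets b = sets M \<and>
    emeasure a (space M) + emeasure b (space M) \<le> ennreal \<epsilon> \<and>
    (\<forall>f\<in>borel_measurable M. (\<integral>\<^sup>+x. (Q ^^ n) f x \<partial>\<mu>) + (\<integral>\<^sup>+x. f x \<partial>b)
      = (\<integral>\<^sup>+x. \<eta> x \<partial>\<mu>) * (\<integral>\<^sup>+x. f x \<partial>\<alpha>) + (\<integral>\<^sup>+x. f x \<partial>a))"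
proof -
  define h where "h = (\<integral>\<^sup>+x. \<eta> x \<partial>\<mu>)"
  have h: "h < \<infinity>" using integral_u_tendsto(2)[OF \<mu>] by (simp add: h_def)
  define b0 where "b0 = scale_measure h \<alpha>"
  have b0: "(\<integral>\<^sup>+x. f x \<partial>b0) = h * (\<integral>\<^sup>+x. f x \<partial>\<alpha>)" if "f \<in> borel_measurable M" for f
    unfolding b0_def using that by (simp add: nn_integral_scale_measure)
  have b0': "sets b0 = sets M" "(\<integral>\<^sup>+x. \<phi> x \<partial>b0) < \<infinity>"
    using h alpha b0 by (auto simp: b0_def ennreal_mult_less_top)
  have "(\<integral>\<^sup>+x. \<eta> x \<partial>\<mu>) = (\<integral>\<^sup>+x. \<eta> x \<partial>b0)"
    by (simp add: b0 alpha_eta h_def)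
  then obtain n a b \<rho> where ab: "sets a = sets M" "sets b = sets M"
    "\<And>f. f \<in> borel_measurable M \<Longrightarrow> (\<integral>\<^sup>+x. (Q ^^ n) f x \<partial>\<mu>) = (\<integral>\<^sup>+x. f x \<partial>a) + \<rho> f"
    "\<And>f. f \<in> borel_measurable M \<Longrightarrow> (\<integral>\<^sup>+x. (Q ^^ n) f x \<partial>b0) = (\<integral>\<^sup>+x. f x \<partial>b) + \<rho> f"
    "(\<integral>\<^sup>+x. \<phi> x \<partial>a) < \<infinity>" "(\<integral>\<^sup>+x. \<phi> x \<partial>b) < \<infinity>"
    "(\<integral>\<^sup>+x. \<eta> x \<partial>a) \<le> ennreal (\<epsilon> / 4)" "(\<integral>\<^sup>+x. \<eta> x \<partial>b) \<le> ennreal (\<epsilon> / 4)"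
    using coupling[OF \<mu> b0', of "\<epsilon> / 4"] \<epsilon> by (metis divide_pos_pos zero_less_numeral)
  have "(\<lambda>k. (\<integral>\<^sup>+x. u k x \<partial>a) + (\<integral>\<^sup>+x. u k x \<partial>b)) \<longlonglongrightarrow> (\<integral>\<^sup>+x. \<eta> x \<partial>a) + (\<integral>\<^sup>+x. \<eta> x \<partial>b)"
    using ab by (intro tendsto_add integral_u_tendsto(1)) auto
  moreover have "(\<integral>\<^sup>+x. \<eta> x \<partial>a) + (\<integral>\<^sup>+x. \<eta> x \<partial>b) < ennreal \<epsilon>"
  proof -
    have "(\<integral>\<^sup>+x. \<eta> x \<partial>a) + (\<integral>\<^sup>+x. \<eta> x \<partial>b) \<le> ennreal (\<epsilon> / 4) + ennreal (\<epsilon> / 4)"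
      using ab by (intro add_mono) auto
    also have "\<dots> < ennreal \<epsilon>"
      using \<epsilon> by (subst ennreal_plus[symmetric]) (auto simp: ennreal_less_iff)
    finally show ?thesis .
  qed
  ultimately have "eventually (\<lambda>k. (\<integral>\<^sup>+x. u k x \<partial>a) + (\<integral>\<^sup>+x. u k x \<partial>b) < ennreal \<epsilon>) sequentially"
    by (rule order_tendstoD)
  then obtain k0 where k0: "\<And>k. k0 \<le> k \<Longrightarrow> (\<integral>\<^sup>+x. u k x \<partial>a) + (\<integral>\<^sup>+x. u k x \<partial>b) < ennreal \<epsilon>"
    by (auto simp: eventually_sequentially)
  have push_f: "(\<integral>\<^sup>+x. f x \<partial>(push ^^ k) s) = (\<integral>\<^sup>+x. (Q ^^ k) f x \<partial>s)"
    if "f \<in> borel_measurable M" "sets s = sets M" for f k s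
    using that space_nonempty by (intro nn_integral_push_pow)
  have push_space: "emeasure ((push ^^ k) s) (space M) = (\<integral>\<^sup>+x. u k x \<partial>s)" if "sets s = sets M" for k s
  proof -
    have "space ((push ^^ k) s) = space M"
      using push_pow_sets[OF that space_nonempty] by (rule sets_eq_imp_space_eq)
    then show ?thesis using push_f[of "\<lambda>_. 1" s k] that by simp
  qed
  show ?thesis
  proof (rule that[of "n + k0"])
    fix n' assume n': "n + k0 \<le> n'"
    define k where "k = n' - n"
    have k: "k0 \<le> k" "n' = n + k" using n' by (auto simp: k_def)
    have "(\<integral>\<^sup>+x. (Q ^^ n') f x \<partial>\<mu>) + (\<integral>\<^sup>+x. f x \<partial>(push ^^ k) b) = h * (\<integral>\<^sup>+x. f x \<partial>\<alpha>) + (\<integral>\<^sup>+x. f x \<partial>(push ^^ k) a)"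
      if f [measurable]: "f \<in> borel_measurable M" for f
    proof -
      have "h * (\<integral>\<^sup>+x. f x \<partial>\<alpha>) = (\<integral>\<^sup>+x. (Q ^^ k) f x \<partial>b) + \<rho> ((Q ^^ k) f)"
        using ab(4)[of "(Q ^^ k) f"] by (simp add: b0 alpha_Q_pow)
      moreover have "(\<integral>\<^sup>+x. (Q ^^ n') f x \<partial>\<mu>) = (\<integral>\<^sup>+x. (Q ^^ k) f x \<partial>a) + \<rho> ((Q ^^ k) f)"
        using ab(3)[of "(Q ^^ k) f"] unfolding k(2) funpow_add comp_def by simp
      ultimately show ?thesis
        using push_f[OF f ab(1)] push_f[OF f ab(2)] by (simp add: ac_simps)
    qed
    then show "\<exists>a b. sets a = sets M \<and> sets b = sets M \<and>
      emeasure a (space M) + emeasure b (space M) \<le> ennreal \<epsilon> \<and>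
      (\<forall>f\<in>borel_measurable M. (\<integral>\<^sup>+x. (Q ^^ n') f x \<partial>\<mu>) + (\<integral>\<^sup>+x. f x \<partial>b)
        = (\<integral>\<^sup>+x. \<eta> x \<partial>\<mu>) * (\<integral>\<^sup>+x. f x \<partial>\<alpha>) + (\<integral>\<^sup>+x. f x \<partial>a))"
      using ab(1,2) k0[OF k(1)] push_pow_sets space_nonempty push_space
      by - (rule exI[of _ "(push ^^ k) a"], rule exI[of _ "(push ^^ k) b"], auto simp: h_def)
  qed
qed

end

section \<open>From the absorbed process to its transition kernels\<close>

context absorbed_markov_process
begin

text \<open>
  The law of \<open>X\<^sub>n\<close> on the event of survival, as a measure on \<open>E\<close>; its total mass is the survival
  probability.
\<close>

definition transition :: "nat \<Rightarrow> 'a \<Rightarrow> 'a measure" where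
  "transition n x = restrict_space (distr (law X x) (extM X) (path X (real n))) (space (stateM X))"

lemma space_extM: "space (extM X) = insert (cem X) (space (stateM X))"
  unfolding extM_def by (rule space_measure_of) (auto dest: sets.sets_into_space)

lemma sets_extM:
  "sets (extM X) = sigma_sets (insert (cem X) (space (stateM X))) (insert {cem X} (sets (stateM X)))"
  unfolding extM_def by (rule sets_measure_of) (auto dest: sets.sets_into_space)

lemma stateM_in_extM: "A \<in> sets (stateM X) \<Longrightarrow> A \<in> sets (extM X)"
  by (auto simp: sets_extM)

lemma extM_trace:
  assumes "A \<in> sets (extM X)"
  shows "A \<inter> space (stateM X) \<in> sets (stateM X)"
  using assms unfolding sets_extM
proof (induction rule: sigma_sets.induct)
  case (Basic A)
  then show ?case using cem_notin by (auto dest: sets.sets_into_space simp: Int_absorb2)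
next
  case (Compl A)
  have "(insert (cem X) (space (stateM X)) - A) \<inter> space (stateM X)
      = space (stateM X) - (A \<inter> space (stateM X))" by auto
  then show ?case using Compl by auto
next
  case (Union A)
  then show ?case by (auto simp: Int_UN_distrib2 UN_extend_simps simp del: UN_simps)
qed auto

lemma sets_restrict_extM: "sets (restrict_space (extM X) (space (stateM X))) = sets (stateM X)"
proof (rule set_eqI, rule iffI)
  fix A assume "A \<in> sets (restrict_space (extM X) (space (stateM X)))"
  then obtain B where "B \<in> sets (extM X)" "A = space (stateM X) \<inter> B" by (auto simp: sets_restrict_space)
  then show "A \<in> sets (stateM X)" using extM_trace[of B] by (simp add: Int_commute)
next
  fix A assume "A \<in> sets (stateM X)"
  then show "A \<in> sets (restrict_space (extM X) (space (stateM X)))"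
    using stateM_in_extM sets.sets_into_space[of A "stateM X"] by (auto simp: sets_restrict_space)
qed

text \<open>
  In the lattice case \<open>n\<close> is the point with index \<open>n * k\<close>.
\<close>

lemma nat_in_times: "real n \<in> times X"
proof -
  from times show ?thesis
  proof
    assume "\<exists>k::nat. k \<ge> 1 \<and> times X = range (\<lambda>n::nat. real n / real k)"
    then obtain k :: nat where k: "k \<ge> 1" "times X = range (\<lambda>n::nat. real n / real k)" by auto
    then have "real n = real (n * k) / real k" by simp
    then show ?thesis unfolding k(2) by blast
  qed simp
qed

lemma path_measurable [measurable]: "path X (real n) \<in> measurable (omega X) (extM X)"
  using measurable_from_subalg[OF filtration(1) adapted] nat_in_times by blast

lemma law_space:
  assumes "x \<in> space (extM X)"
  shows "sets (law X x) = sets (omega X)" "prob_space (law X x)" "space (law X x) = space (omega X)"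
proof -
  have "law X x \<in> space (prob_algebra (omega X))"
    using measurable_space[OF law_kernel assms] .
  then show "sets (law X x) = sets (omega X)" "prob_space (law X x)"
    by (auto simp: space_prob_algebra)
  then show "space (law X x) = space (omega X)" by (auto dest: sets_eq_imp_space_eq)
qed

lemma path_measurable_law: "x \<in> space (extM X) \<Longrightarrow> path X (real n) \<in> measurable (law X x) (extM X)"
  using path_measurable law_space(1) by (simp cong: measurable_cong_sets)

lemma state_in_ext: "x \<in> space (stateM X) \<Longrightarrow> x \<in> space (extM X)"
  by (simp add: space_extM)

lemma space_stateM_extM: "space (stateM X) \<in> sets (extM X)"
  by (rule stateM_in_extM) simp

lemma state_Int_ext [simp]: "space (stateM X) \<inter> space (extM X) = space (stateM X)"
  by (auto simp: space_extM)

lemma space_transition [simp]: "space (transition n x) = space (stateM X)"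
  by (auto simp: transition_def space_restrict_space space_extM)

lemma sets_transition [simp]: "sets (transition n x) = sets (stateM X)"
proof -
  have "sets (transition n x) = sets (restrict_space (extM X) (space (stateM X)))"
    by (simp add: transition_def sets_restrict_space)
  then show ?thesis by (simp add: sets_restrict_extM)
qed

lemma measurable_transition [simp]: "borel_measurable (transition n x) = borel_measurable (stateM X)"
  by (rule measurable_cong_sets) auto

lemma transition_kernel:
  assumes "space (stateM X) \<noteq> {}"
  shows "transition n \<in> measurable (stateM X) (subprob_algebra (stateM X))"
proof -
  have id: "(\<lambda>x. x) \<in> measurable (stateM X) (extM X)"
    by (intro measurableI) (auto intro: state_in_ext extM_trace simp: vimage_def Int_def
      dest: extM_trace)
  have law: "(\<lambda>x. law X x) \<in> measurable (stateM X) (subprob_algebra (omega X))"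
    using measurable_compose[OF id measurable_prob_algebraD[OF law_kernel]] .
  have "(\<lambda>x. distr (law X x) (extM X) (path X (real n))) \<in> measurable (stateM X) (subprob_algebra (extM X))"
    by (rule measurable_compose[OF law measurable_distr]) measurable
  from restrict_space_measurable[OF assms space_stateM_extM this]
  show ?thesis
    unfolding transition_def[abs_def] subprob_algebra_cong[OF sets_restrict_extM] .
qed

lemma emeasure_transition:
  assumes x: "x \<in> space (extM X)" and A: "A \<in> sets (stateM X)"
  shows "emeasure (transition n x) A = emeasure (law X x) (path X (real n) -` A \<inter> space (omega X))"
proof -
  have "emeasure (transition n x) A = emeasure (distr (law X x) (extM X) (path X (real n))) A"
    unfolding transition_def using A space_stateM_extM sets.sets_into_space[OF A]
    by (intro emeasure_restrict_space) auto
  also have "\<dots> = emeasure (law X x) (path X (real n) -` A \<inter> space (omega X))"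
    using A law_space(3)[OF x] path_measurable_law[OF x] by (subst emeasure_distr) (auto intro: stateM_in_extM)
  finally show ?thesis .
qed

lemma measure_transition:
  assumes x: "x \<in> space (extM X)" and A: "A \<in> sets (stateM X)"
  shows "measure (transition n x) A = measure (law X x) (path X (real n) -` A \<inter> space (omega X))"
  by (simp add: measure_def emeasure_transition[OF assms])

lemma nn_integral_transition:
  assumes x: "x \<in> space (extM X)" and f: "f \<in> borel_measurable (stateM X)"
  shows "(\<integral>\<^sup>+y. f y \<partial>transition n x)
    = (\<integral>\<^sup>+\<omega>. f (path X (real n) \<omega>) * indicator (space (stateM X)) (path X (real n) \<omega>) \<partial>law X x)"
proof -
  have "f \<in> borel_measurable (restrict_space (extM X) (space (stateM X)))"
    using f measurable_cong_sets[OF sets_restrict_extM refl] by blast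
  then have meas: "(\<lambda>y. f y * indicator (space (stateM X)) y) \<in> borel_measurable (extM X)"
    using space_stateM_extM by (subst (asm) borel_measurable_restrict_space_iff_ennreal) auto
  have "(\<integral>\<^sup>+y. f y \<partial>transition n x)
      = (\<integral>\<^sup>+y. f y * indicator (space (stateM X)) y \<partial>distr (law X x) (extM X) (path X (real n)))"
    unfolding transition_def using space_stateM_extM
    by (intro nn_integral_restrict_space) auto
  then show ?thesis using path_measurable_law[OF x] meas by (simp add: nn_integral_distr)
qed

lemma transition_0:
  assumes x: "x \<in> space (stateM X)"
  shows "transition 0 x = return (stateM X) x"
proof (rule measure_eqI)
  fix A assume "A \<in> sets (transition 0 x)"
  then have A: "A \<in> sets (stateM X)" by simp
  have "emeasure (transition 0 x) A = emeasure (distr (law X x) (extM X) (path X 0)) A"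
    unfolding transition_def of_nat_0 using A space_stateM_extM sets.sets_into_space[OF A]
    by (intro emeasure_restrict_space) auto
  also have "\<dots> = emeasure (return (stateM X) x) A"
    using start[OF state_in_ext[OF x]] A by (simp add: stateM_in_extM)
  finally show "emeasure (transition 0 x) A = emeasure (return (stateM X) x) A" .
qed simp

lemma alive_imp_in_state:
  assumes "\<omega> \<in> alive X n"
  shows "path X (real n) \<omega> \<in> space (stateM X)"
proof -
  have \<omega>: "\<omega> \<in> space (omega X)" "\<not> absorption_time X \<omega> \<le> ereal (real n)"
    using assms by (auto simp: alive_def not_le)
  then have "path X (real n) \<omega> \<noteq> cem X"
    using nat_in_times[of n] unfolding absorption_time_def by (auto intro: INF_lower)
  with measurable_space[OF path_measurable \<omega>(1)] show ?thesis by (auto simp: space_extM)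
qed

lemma hits_space_Int_alive: "hits X n (space (stateM X)) \<inter> alive X n = alive X n"
  using alive_imp_in_state by (auto simp: hits_def alive_def)

text \<open>
  Up to a null set, survival up to time \<open>n\<close> is a measurable event that concerns \<open>X\<^sub>n\<close> alone:
  by absorption, a path in \<open>E\<close> at time \<open>n\<close> almost surely has not met \<open>\<partial>\<close> before.
\<close>

lemma AE_alive:
  assumes x: "x \<in> space (extM X)"
  shows "AE \<omega> in law X x. \<omega> \<in> alive X n \<longleftrightarrow> path X (real n) \<omega> \<in> space (stateM X)"
  using absorbed[OF x] AE_space
proof eventually_elim
  case (elim \<omega>)
  show ?case
  proof
    assume "path X (real n) \<omega> \<in> space (stateM X)"
    then have "path X (real n) \<omega> \<noteq> cem X" using cem_notin by auto
    with elim(1) nat_in_times[of n] have "\<not> absorption_time X \<omega> \<le> ereal (real n)" by blast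
    with elim(2) show "\<omega> \<in> alive X n" by (simp add: alive_def not_le law_space(3)[OF x])
  qed (rule alive_imp_in_state)
qed

lemma prob_from_hits_alive:
  assumes x: "x \<in> space (extM X)" and A: "A \<in> sets (stateM X)"
  shows "prob_from X x (hits X n A \<inter> alive X n) = measure (transition n x) A"
proof -
  let ?A = "path X (real n) -` A \<inter> space (omega X)"
  have A': "?A \<in> sets (law X x)"
    using measurable_sets[OF path_measurable stateM_in_extM[OF A]] law_space(1)[OF x] by simp
  have ae: "AE \<omega> in completion (law X x). \<omega> \<in> ?A \<longleftrightarrow> \<omega> \<in> hits X n A \<inter> alive X n"
    using AE_completion[OF AE_alive[OF x, of n]] AE_space
  proof eventually_elim
    case (elim \<omega>)
    then show ?case
      using sets.sets_into_space[OF A] law_space(3)[OF x] by (auto simp: hits_def)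
  qed
  have B: "hits X n A \<inter> alive X n \<in> sets (completion (law X x))"
    using A' by (intro completion.in_sets_AE[OF ae]) (auto simp: hits_def law_space(3)[OF x])
  have "measure (completion (law X x)) (hits X n A \<inter> alive X n) = measure (completion (law X x)) ?A"
    using ae A' B by (intro measure_eq_AE) auto
  also have "\<dots> = measure (law X x) ?A" using A' by simp
  finally show ?thesis by (simp add: prob_from_def measure_transition[OF x A])
qed

lemma prob_from_alive:
  assumes x: "x \<in> space (extM X)"
  shows "prob_from X x (alive X n) = measure (transition n x) (space (stateM X))"
  using prob_from_hits_alive[OF x sets.top, of n] by (simp add: hits_space_Int_alive)

lemma prob_from_hits:
  assumes x: "x \<in> space (extM X)" and A: "A \<in> sets (stateM X)"
  shows "prob_from X x (hits X n A) = measure (transition n x) A"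
proof -
  have "hits X n A = path X (real n) -` A \<inter> space (omega X)" by (auto simp: hits_def)
  moreover have "path X (real n) -` A \<inter> space (omega X) \<in> sets (law X x)"
    using measurable_sets[OF path_measurable stateM_in_extM[OF A]] law_space(1)[OF x] by simp
  ultimately show ?thesis by (simp add: prob_from_def measure_transition[OF assms])
qed

lemma semigrp_eq:
  assumes x: "x \<in> space (extM X)" and f: "f \<in> borel_measurable (stateM X)"
  shows "semigrp X n f x = (\<integral>\<^sup>+y. ennreal (f y) \<partial>transition n x)"
proof -
  have "semigrp X n f x = (\<integral>\<^sup>+ \<omega>. ennreal (f (path X (real n) \<omega>)) * indicator (alive X n) \<omega> \<partial>law X x)"
    by (simp add: semigrp_def nn_integral_completion)
  also have "\<dots> = (\<integral>\<^sup>+\<omega>. ennreal (f (path X (real n) \<omega>)) * indicator (space (stateM X)) (path X (real n) \<omega>) \<partial>law X x)"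
    using AE_alive[OF x, of n] by (intro nn_integral_cong_AE, eventually_elim) (auto split: split_indicator)
  also have "\<dots> = (\<integral>\<^sup>+y. ennreal (f y) \<partial>transition n x)"
    using f by (subst nn_integral_transition[OF x]) auto
  finally show ?thesis .
qed

text \<open>
  A path started at \<open>\<partial>\<close> has absorption time at most \<open>0\<close>. This removes the contribution of
  \<open>\<partial>\<close> from the Markov property.
\<close>

lemma measure_law_cem:
  assumes A: "A \<in> sets (stateM X)"
  shows "measure (law X (cem X)) (path X (real n) -` A \<inter> space (omega X)) = 0"
proof -
  have x: "cem X \<in> space (extM X)" by (simp add: space_extM)
  have "AE y in distr (law X (cem X)) (extM X) (path X 0). y = cem X"
    unfolding start[OF x] using x by (subst AE_return) (auto simp: sets_extM pred_def intro!: sigma_sets.Basic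
      simp: space_extM)
  then have "AE \<omega> in law X (cem X). path X 0 \<omega> = cem X"
    using path_measurable_law[OF x, of 0] by (auto dest: AE_distrD)
  with absorbed[OF x] have "AE \<omega> in law X (cem X). path X (real n) \<omega> = cem X"
  proof eventually_elim
    case (elim \<omega>)
    have "absorption_time X \<omega> \<le> ereal 0"
      unfolding absorption_time_def using elim(2) nat_in_times[of 0] by (intro INF_lower) auto
    also have "\<dots> \<le> ereal (real n)" by simp
    finally show ?case using elim(1) nat_in_times by blast
  qed
  then have "AE \<omega> in law X (cem X). \<omega> \<notin> path X (real n) -` A \<inter> space (omega X)"
    by eventually_elim (use cem_notin sets.sets_into_space[OF A] in auto)
  then have "emeasure (law X (cem X)) (path X (real n) -` A \<inter> space (omega X)) = 0"
    using measurable_sets[OF path_measurable stateM_in_extM[OF A]] law_space(1,3)[OF x]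
    by (subst (asm) AE_iff_measurable[of "path X (real n) -` A \<inter> space (omega X)"]) auto
  then show ?thesis by (simp add: measure_def)
qed

text \<open>
  Chapman-Kolmogorov for the killed process: the expectation of the conditional probability in the Markov
  property is the unconditional one, and conditional probabilities starting from \<open>\<partial>\<close> vanish.
\<close>

lemma transition_Suc:
  assumes x: "x \<in> space (stateM X)"
  shows "transition (Suc n) x = transition n x \<bind> transition 1"
proof (rule measure_eqI)
  have ne: "space (stateM X) \<noteq> {}" using x by auto
  have k: "transition 1 \<in> measurable (transition n x) (subprob_algebra (stateM X))"
    using transition_kernel[OF ne, of 1] by (simp cong: measurable_cong_sets)
  show "sets (transition (Suc n) x) = sets (transition n x \<bind> transition 1)"
    using ne by (subst sets_bind) auto
  fix A assume "A \<in> sets (transition (Suc n) x)"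
  then have A: "A \<in> sets (stateM X)" by simp
  note xe = state_in_ext[OF x]
  interpret prob_space "law X x" by (rule law_space(2)[OF xe])
  define I where "I = (\<lambda>\<omega>. measure (law X (path X (real n) \<omega>)) (path X (real 1) -` A \<inter> space (omega X)))"
  let ?S = "path X (real (Suc n)) -` A \<inter> space (omega X)"
  have S: "?S \<in> sets (law X x)"
    unfolding law_space(1)[OF xe] by (rule measurable_sets[OF path_measurable stateM_in_extM[OF A]])
  have sub: "subalgebra (law X x) (filtr X (real n))"
    using filtration(1)[OF nat_in_times[of n]] law_space[OF xe] by (auto simp: subalgebra_def)
  interpret finite_measure_subalgebra "law X x" "filtr X (real n)"
    by unfold_locales (rule sub)
  have I_eq: "I \<omega> = measure (transition 1 (path X (real n) \<omega>)) A * indicator (space (stateM X)) (path X (real n) \<omega>)"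
    if "\<omega> \<in> space (omega X)" for \<omega>
  proof -
    have "path X (real n) \<omega> \<in> space (extM X)" using path_measurable that by (rule measurable_space)
    then show ?thesis
      using measure_transition[OF _ A, of "path X (real n) \<omega>" 1] measure_law_cem[OF A, of 1] cem_notin
      by (auto simp: I_def space_extM split: split_indicator)
  qed
  have meas_t: "(\<lambda>y. measure (transition 1 y) A) \<in> borel_measurable (stateM X)"
    by (rule measure_measurable_subprob_algebra2[OF _ transition_kernel[OF ne]])
       (use A in \<open>auto intro!: pair_measureI\<close>)
  have I_nn: "(\<integral>\<^sup>+\<omega>. ennreal (I \<omega>) \<partial>law X x) = (\<integral>\<^sup>+y. ennreal (measure (transition 1 y) A) \<partial>transition n x)"
    using meas_t law_space(3)[OF xe]
    by (subst nn_integral_transition[OF xe]) (auto intro!: nn_integral_cong simp: I_eq split: split_indicator)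
  have ae: "AE \<omega> in law X x. real_cond_exp (law X x) (filtr X (real n)) (indicator ?S) \<omega> = I \<omega>"
    using markov[OF xe nat_in_times[of n] nat_in_times[of 1] stateM_in_extM[OF A]]
    by (simp add: I_def add.commute)
  have int: "integrable (law X x) (indicator ?S :: _ \<Rightarrow> real)"
    by (rule integrable_real_indicator[OF S]) (simp add: emeasure_eq_measure)
  have intc: "integrable (law X x) (real_cond_exp (law X x) (filtr X (real n)) (indicator ?S))"
    by (rule real_cond_exp_int(1)[OF int])
  have "emeasure (transition (Suc n) x) A = ennreal (\<integral>\<omega>. indicator ?S \<omega> \<partial>law X x)"
    using S by (simp add: emeasure_transition[OF xe A] emeasure_eq_measure)
  also have "\<dots> = ennreal (\<integral>\<omega>. real_cond_exp (law X x) (filtr X (real n)) (indicator ?S) \<omega> \<partial>law X x)"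
    by (simp only: real_cond_exp_int(2)[OF int])
  also have "\<dots> = (\<integral>\<^sup>+\<omega>. ennreal (real_cond_exp (law X x) (filtr X (real n)) (indicator ?S) \<omega>) \<partial>law X x)"
    using ae by (intro nn_integral_eq_integral[symmetric] intc, eventually_elim) (simp add: I_def)
  also have "\<dots> = (\<integral>\<^sup>+\<omega>. ennreal (I \<omega>) \<partial>law X x)"
    using ae by (intro nn_integral_cong_AE, eventually_elim) simp
  also have "\<dots> = (\<integral>\<^sup>+y. emeasure (transition 1 y) A \<partial>transition n x)"
    unfolding I_nn
  proof (intro nn_integral_cong)
    fix y assume "y \<in> space (transition n x)"
    then have "subprob_space (transition 1 y)"
      using measurable_space[OF transition_kernel[OF ne, of 1], of y] by (simp add: space_subprob_algebra)
    then interpret t: subprob_space "transition 1 y" .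
    show "ennreal (measure (transition 1 y) A) = emeasure (transition 1 y) A"
      by (rule t.emeasure_eq_measure[symmetric])
  qed
  also have "\<dots> = emeasure (transition n x \<bind> transition 1) A"
    using ne k A by (subst emeasure_bind) auto
  finally show "emeasure (transition (Suc n) x) A = emeasure (transition n x \<bind> transition 1) A" .
qed

lemma iterated_operator:
  assumes r: "0 < r" "r < \<infinity>" and x: "x \<in> space (stateM X)" and f: "f \<in> borel_measurable (stateM X)"
  shows "(scaled_kernel.Q (transition 1) r ^^ n) f x = r ^ n * (\<integral>\<^sup>+y. f y \<partial>transition n x)"
proof -
  have ne: "space (stateM X) \<noteq> {}" using x by auto
  interpret scaled_kernel "stateM X" "transition 1" r
    by unfold_locales (use transition_kernel[OF ne] r in auto)
  show ?thesis using f
  proof (induction n arbitrary: f)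
    case 0
    then show ?case using x by (simp add: transition_0 nn_integral_return)
  next
    case (Suc n)
    have k: "transition 1 \<in> measurable (transition n x) (subprob_algebra (stateM X))"
      using transition_kernel[OF ne, of 1] by (simp cong: measurable_cong_sets)
    have "(Q ^^ Suc n) f x = r ^ n * (\<integral>\<^sup>+y. Q f y \<partial>transition n x)"
      using Suc.IH[OF Q_measurable[OF Suc.prems]] by (simp add: funpow_swap1)
    also have "(\<integral>\<^sup>+y. Q f y \<partial>transition n x) = r * (\<integral>\<^sup>+y. (\<integral>\<^sup>+z. f z \<partial>transition 1 y) \<partial>transition n x)"
      unfolding Q_def
      by (rule nn_integral_cmult, rule nn_integral_measurable_subprob_algebra2[where N = "stateM X"])
         (use Suc.prems k in measurable)
    also have "(\<integral>\<^sup>+y. (\<integral>\<^sup>+z. f z \<partial>transition 1 y) \<partial>transition n x) = (\<integral>\<^sup>+z. f z \<partial>transition (Suc n) x)"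
      by (simp only: transition_Suc[OF x] nn_integral_bind[OF Suc.prems k])
    finally show ?case by (simp add: ac_simps)
  qed
qed

lemma prob_init_hits_alive:
  assumes \<mu>: "\<mu> \<in> space (prob_algebra (stateM X))" and A: "A \<in> sets (stateM X)"
  shows "ennreal (prob_init X \<mu> (hits X n A \<inter> alive X n)) = (\<integral>\<^sup>+x. emeasure (transition n x) A \<partial>\<mu>)"
proof -
  have sets: "sets \<mu> = sets (stateM X)" and "prob_space \<mu>" using \<mu> by (auto simp: space_prob_algebra)
  then interpret prob_space \<mu> by simp
  have sp: "space \<mu> = space (stateM X)" using sets by (rule sets_eq_imp_space_eq)
  then have ne: "space (stateM X) \<noteq> {}" using not_empty by simp
  have sub: "subprob_space (transition n x)" if "x \<in> space \<mu>" for x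
    using measurable_space[OF transition_kernel[OF ne, of n], of x] that sp by (simp add: space_subprob_algebra)
  have "(\<lambda>x. measure (transition n x) A) \<in> borel_measurable (stateM X)"
    by (rule measure_measurable_subprob_algebra2[OF _ transition_kernel[OF ne]])
       (use A in \<open>auto intro!: pair_measureI\<close>)
  then have int: "integrable \<mu> (\<lambda>x. measure (transition n x) A)"
    using sub sets
    by (intro integrable_const_bound[where B = 1])
       (auto intro!: AE_I2 subprob_space.subprob_measure_le_1 cong: measurable_cong_sets)
  have "prob_init X \<mu> (hits X n A \<inter> alive X n) = (\<integral>x. measure (transition n x) A \<partial>\<mu>)"
    unfolding prob_init_def
    by (intro Bochner_Integration.integral_cong) (auto simp: sp prob_from_hits_alive[OF state_in_ext A])
  also have "ennreal \<dots> = (\<integral>\<^sup>+x. ennreal (measure (transition n x) A) \<partial>\<mu>)"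
    using int by (intro nn_integral_eq_integral[symmetric]) auto
  also have "\<dots> = (\<integral>\<^sup>+x. emeasure (transition n x) A \<partial>\<mu>)"
  proof (intro nn_integral_cong)
    fix x assume "x \<in> space \<mu>"
    then interpret t: subprob_space "transition n x" by (rule sub)
    show "ennreal (measure (transition n x) A) = emeasure (transition n x) A"
      by (simp add: t.emeasure_eq_measure)
  qed
  finally show ?thesis .
qed

lemma prob_init_nonneg: "0 \<le> prob_init X \<mu> A"
  by (simp add: prob_init_def prob_from_def)

end

section \<open>Powers, total variation and the logarithmic condition\<close>

lemma add_powr_le:
  fixes a b q :: real
  assumes "0 < a" "0 < b" "0 < q" "q \<le> 1"
  shows "(a + b) powr q \<le> a powr q + b powr q"
proof -
  have split: "t powr q = t * t powr (q - 1)" if "0 < t" for t :: real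
    using that by (simp add: powr_mult_base)
  have "(a + b) powr q = a * (a + b) powr (q - 1) + b * (a + b) powr (q - 1)"
    using assms by (simp add: split distrib_right)
  also have "\<dots> \<le> a * a powr (q - 1) + b * b powr (q - 1)"
    using assms by (intro add_mono mult_left_mono powr_mono2') auto
  also have "\<dots> = a powr q + b powr q"
    using assms by (simp add: split)
  finally show ?thesis .
qed

text \<open>
  Jensen's inequality for the concave function \<open>y \<mapsto> y powr q\<close>, in the form needed for sub-probability
  measures: integrate the tangent at \<open>t\<close>, which lies above the graph and has a nonnegative constant
  term.
\<close>

lemma nn_integral_powr_le:
  assumes "subprob_space m" and f [measurable]: "f \<in> borel_measurable m"
    and pos: "\<And>y. y \<in> space m \<Longrightarrow> 0 < f y"
    and le: "(\<integral>\<^sup>+y. ennreal (f y) \<partial>m) \<le> ennreal t" and t: "0 < t" and q: "0 < q" "q \<le> (1::real)"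
  shows "(\<integral>\<^sup>+y. ennreal (f y powr q) \<partial>m) \<le> ennreal (t powr q)"
proof -
  interpret subprob_space m by fact
  have tangent: "f y powr q \<le> t powr (q - 1) * (q * f y + (1 - q) * t)" if y: "y \<in> space m" for y
  proof -
    have "f y powr q = t powr (q - 1) * (f y powr q * t powr (1 - q))"
      using t by (simp add: ac_simps flip: powr_add)
    also have "\<dots> \<le> t powr (q - 1) * (q * f y + (1 - q) * t)"
      using pos[OF y] t q by (intro mult_left_mono Youngs_inequality_0) auto
    finally show ?thesis .
  qed
  have "(\<integral>\<^sup>+y. ennreal (f y powr q) \<partial>m)
      \<le> (\<integral>\<^sup>+y. ennreal (t powr (q - 1)) * (ennreal q * ennreal (f y) + ennreal ((1 - q) * t)) \<partial>m)"
  proof (intro nn_integral_mono)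
    fix y assume y: "y \<in> space m"
    have "ennreal (f y powr q) \<le> ennreal (t powr (q - 1) * (q * f y + (1 - q) * t))"
      using tangent[OF y] by (rule ennreal_leI)
    also have "\<dots> = ennreal (t powr (q - 1)) * (ennreal q * ennreal (f y) + ennreal ((1 - q) * t))"
      using pos[OF y] t q by (simp add: ennreal_mult)
    finally show "ennreal (f y powr q) \<le> \<dots>" .
  qed
  also have "\<dots> = ennreal (t powr (q - 1)) *
      (ennreal q * (\<integral>\<^sup>+y. ennreal (f y) \<partial>m) + ennreal ((1 - q) * t) * emeasure m (space m))"
    by (simp add: nn_integral_cmult nn_integral_add)
  also have "\<dots> \<le> ennreal (t powr (q - 1)) * (ennreal q * ennreal t + ennreal ((1 - q) * t) * 1)"
    using le emeasure_space_le_1 by (intro mult_left_mono add_mono) auto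
  also have "\<dots> = ennreal (t powr (q - 1) * (q * t + (1 - q) * t))"
    using t q by (simp add: ennreal_mult)
  also have "t powr (q - 1) * (q * t + (1 - q) * t) = t powr q"
    using t powr_mult_base[of t "q - 1"] by (simp add: algebra_simps)
  finally show ?thesis .
qed

lemma powr_less_if_less_log_quotient:
  assumes "0 < \<theta>1" "\<theta>1 < \<theta>2" "\<theta>2 \<le> 1" "1 \<le> p" "ereal p < log_quotient \<theta>1 \<theta>2"
  shows "\<theta>1 powr (1 / p) < \<theta>2"
proof (cases "\<theta>2 = 1")
  case True
  then show ?thesis using assms powr_less_mono2[of "1 / p" \<theta>1 1] by simp
next
  case False
  then have ln: "ln \<theta>2 < 0" using assms by simp
  have "p < ln \<theta>1 / ln \<theta>2" using assms(5) False by (simp add: log_quotient_def)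
  then have "ln \<theta>1 < p * ln \<theta>2" using ln by (simp add: neg_less_divide_eq)
  then have "ln \<theta>1 / p < ln \<theta>2" using assms(4) by (simp add: field_simps)
  then have "exp (ln \<theta>1 / p) < exp (ln \<theta>2)" by simp
  then show ?thesis using assms by (simp add: powr_def)
qed

lemma tv_norm_ge:
  assumes A: "A \<in> sets M"
  shows "ennreal \<bar>m A\<bar> \<le> tv_norm M m"
proof -
  let ?P = "{A, space M - A}"
  have "\<bar>m A\<bar> \<le> (\<Sum>A\<in>?P. \<bar>m A\<bar>)"
    by (rule member_le_sum) auto
  then have "ennreal \<bar>m A\<bar> \<le> ennreal (\<Sum>A\<in>?P. \<bar>m A\<bar>)" by (rule ennreal_leI)
  also have "\<dots> \<le> tv_norm M m"
    unfolding tv_norm_def using A sets.sets_into_space[OF A]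
    by (intro SUP_upper) (auto simp: disjoint_def)
  finally show ?thesis .
qed

lemma sum_measure_partition:
  assumes "finite_measure a" "sets a = sets M"
    and P: "finite P" "P \<subseteq> sets M" "disjoint P" "\<Union>P = space M"
  shows "(\<Sum>A\<in>P. measure a A) = measure a (space M)"
proof -
  interpret finite_measure a by fact
  have "measure a (\<Union>A\<in>P. A) = (\<Sum>A\<in>P. measure a A)"
    using P assms(2) by (intro finite_measure_finite_Union) (auto simp: disjoint_family_on_def disjoint_def)
  then show ?thesis using P(4) by simp
qed

section \<open>The domain of attraction of the quasi-stationary distribution\<close>

locale qsd_setting =
  absorbed_markov_process X + assumption_E X n1 \<theta>1 \<theta>2 c1 c2 c3 \<phi>1 \<phi>2 \<nu> K
  for X :: "('w, 'a, 'z) process_scheme" and n1 :: nat and \<theta>1 \<theta>2 c1 c2 c3 :: real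
    and \<phi>1 \<phi>2 :: "'a \<Rightarrow> real" and \<nu> :: "'a measure" and K :: "'a set" +
  fixes \<nu>QSD :: "'a measure" and \<theta>0 :: real and \<eta> :: "'a \<Rightarrow> real"
  assumes QSD: "quasi_stationary X \<nu>QSD"
      "(\<integral>\<^sup>+x. ennreal (\<phi>1 x) \<partial>\<nu>QSD) < \<infinity>" "(\<integral>\<^sup>+x. ennreal (\<phi>2 x) \<partial>\<nu>QSD) > 0"
    and theta0: "0 < \<theta>0" "\<theta>0 \<le> 1" "\<And>n. n \<ge> 1 \<Longrightarrow> prob_init X \<nu>QSD (alive X n) = \<theta>0 ^ n"
    and eta_limit: "\<And>x. x \<in> space (stateM X) \<Longrightarrow>
      (\<lambda>n. prob_from X x (alive X n) / \<theta>0 ^ n) \<longlonglongrightarrow> \<eta> x"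
begin

lemma QSD_prob: "\<nu>QSD \<in> space (prob_algebra (stateM X))"
  using QSD(1) by (simp add: quasi_stationary_def)

lemma sets_QSD: "sets \<nu>QSD = sets (stateM X)" and prob_QSD: "prob_space \<nu>QSD"
  using QSD_prob by (auto simp: space_prob_algebra)

lemma space_QSD: "space \<nu>QSD = space (stateM X)"
  using sets_QSD by (rule sets_eq_imp_space_eq)

lemma state_nonempty: "space (stateM X) \<noteq> {}"
  using prob_space.not_empty[OF prob_QSD] space_QSD by simp

lemma K_state: "x \<in> K \<Longrightarrow> x \<in> space (stateM X)"
  using sets.sets_into_space[OF K_sets] by auto

lemma subprob_transition: "x \<in> space (stateM X) \<Longrightarrow> subprob_space (transition n x)"
  using measurable_space[OF transition_kernel[OF state_nonempty, of n]] by (simp add: space_subprob_algebra)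

lemma emeasure_eq_measure_transition:
  assumes "x \<in> space (stateM X)"
  shows "emeasure (transition n x) A = ennreal (measure (transition n x) A)"
proof -
  interpret subprob_space "transition n x" by (rule subprob_transition[OF assms])
  show ?thesis by (rule emeasure_eq_measure)
qed

text \<open>
  The measure \<open>\<nu>\<close> of (E1) lives on the trace space of \<open>K\<close>; this is its image in \<open>E\<close>.
\<close>

definition \<nu>K :: "'a measure" where
  "\<nu>K = distr \<nu> (stateM X) (\<lambda>x. x)"

lemma nu_facts: "sets \<nu> = sets (restrict_space (stateM X) K)" "prob_space \<nu>" "space \<nu> = K"
proof -
  show *: "sets \<nu> = sets (restrict_space (stateM X) K)" "prob_space \<nu>"
    using nu_prob by (auto simp: space_prob_algebra)
  have "space \<nu> = space (restrict_space (stateM X) K)"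
    using *(1) by (rule sets_eq_imp_space_eq)
  also have "\<dots> = K"
    using K_state by (auto simp: space_restrict_space)
  finally show "space \<nu> = K" .
qed

lemma id_measurable_nu: "(\<lambda>x. x) \<in> measurable \<nu> (stateM X)"
  using measurable_restrict_space1[OF measurable_ident, of "stateM X" K] nu_facts(1)
  by (simp add: id_def cong: measurable_cong_sets)

lemma emeasure_nuK:
  "A \<in> sets (stateM X) \<Longrightarrow> emeasure \<nu>K A = ennreal (measure \<nu> (A \<inter> K))"
proof -
  interpret prob_space \<nu> by (rule nu_facts(2))
  assume "A \<in> sets (stateM X)"
  then show ?thesis
    unfolding \<nu>K_def using nu_facts(3)
    by (subst emeasure_distr[OF id_measurable_nu]) (simp_all add: emeasure_eq_measure)
qed

abbreviation r where "r \<equiv> ennreal (1 / \<theta>0)"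

lemma r: "0 < r" "r < \<infinity>"
  using theta0 by auto

sublocale Q: scaled_kernel "stateM X" "transition 1" r
  by unfold_locales (use transition_kernel[OF state_nonempty] r in auto)

lemma Q_pow_eq:
  assumes "x \<in> space (stateM X)" "f \<in> borel_measurable (stateM X)"
  shows "(Q.Q ^^ n) f x = ennreal (1 / \<theta>0 ^ n) * (\<integral>\<^sup>+y. f y \<partial>transition n x)"
  using iterated_operator[OF r assms] theta0 by (simp add: ennreal_power power_one_over)

lemma Q_pow_semigrp:
  assumes "x \<in> space (stateM X)" "f \<in> borel_measurable (stateM X)"
  shows "(Q.Q ^^ n) (\<lambda>y. ennreal (f y)) x = ennreal (1 / \<theta>0 ^ n) * semigrp X n f x"
  using Q_pow_eq[OF assms(1), of "\<lambda>y. ennreal (f y)"] semigrp_eq[OF state_in_ext[OF assms(1)] assms(2)] assms(2)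
  by simp

lemma Q_pow_indicator:
  assumes "x \<in> space (stateM X)" "A \<in> sets (stateM X)"
  shows "(Q.Q ^^ n) (indicator A) x = ennreal (measure (transition n x) A / \<theta>0 ^ n)"
  using Q_pow_eq[OF assms(1), of "indicator A"] assms theta0
  by (simp add: emeasure_eq_measure_transition ennreal_mult[symmetric])

lemma Q_pow_one:
  assumes "x \<in> space (stateM X)"
  shows "(Q.Q ^^ n) (\<lambda>_. 1) x = ennreal (prob_from X x (alive X n) / \<theta>0 ^ n)"
proof -
  have "(Q.Q ^^ n) (\<lambda>_. 1) x = (Q.Q ^^ n) (indicator (space (stateM X))) x"
    using assms by (intro Q.Q_pow_cong) auto
  then show ?thesis
    using Q_pow_indicator[OF assms sets.top] by (simp add: prob_from_alive[OF state_in_ext[OF assms]])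
qed

text \<open>
  Quasi-stationarity at time \<open>1\<close> is the eigenvalue equation \<open>\<alpha> P = \<theta>0 \<alpha>\<close>, because the conditioning
  event has probability \<open>\<theta>0\<close>.
\<close>

lemma QSD_Q:
  assumes f: "f \<in> borel_measurable (stateM X)"
  shows "(\<integral>\<^sup>+x. Q.Q f x \<partial>\<nu>QSD) = (\<integral>\<^sup>+x. f x \<partial>\<nu>QSD)"
proof -
  interpret prob_space \<nu>QSD by (rule prob_QSD)
  have sets: "sets (Q.push \<nu>QSD) = sets (stateM X)"
    by (rule Q.sets_push[OF sets_QSD state_nonempty])
  have "Q.push \<nu>QSD = \<nu>QSD"
  proof (rule measure_eqI)
    fix A assume "A \<in> sets (Q.push \<nu>QSD)"
    then have A: "A \<in> sets (stateM X)" using sets by simp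
    have "cond_law X \<nu>QSD 1 A = measure \<nu>QSD A"
      using QSD(1) A unfolding quasi_stationary_def by blast
    then have "prob_init X \<nu>QSD (hits X 1 A \<inter> alive X 1) = \<theta>0 * measure \<nu>QSD A"
      using theta0(1) theta0(3)[of 1] by (simp add: cond_law_def field_simps)
    then have "ennreal (\<theta>0 * measure \<nu>QSD A) = (\<integral>\<^sup>+x. emeasure (transition 1 x) A \<partial>\<nu>QSD)"
      using prob_init_hits_alive[OF QSD_prob A, of 1] by simp
    then have "r * (\<integral>\<^sup>+x. emeasure (transition 1 x) A \<partial>\<nu>QSD) = r * ennreal (\<theta>0 * measure \<nu>QSD A)"
      by simp
    also have "\<dots> = emeasure \<nu>QSD A"
      using theta0 by (simp add: emeasure_eq_measure flip: ennreal_mult)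
    finally have "r * (\<integral>\<^sup>+x. emeasure (transition 1 x) A \<partial>\<nu>QSD) = emeasure \<nu>QSD A" .
    moreover have "emeasure (Q.push \<nu>QSD) A = r * (\<integral>\<^sup>+x. emeasure (transition 1 x) A \<partial>\<nu>QSD)"
    proof -
      have "transition 1 \<in> measurable \<nu>QSD (subprob_algebra (stateM X))"
        using transition_kernel[OF state_nonempty, of 1] sets_QSD by (simp cong: measurable_cong_sets)
      then show ?thesis
        unfolding Q.push_def using A not_empty by (simp add: emeasure_bind)
    qed
    ultimately show "emeasure (Q.push \<nu>QSD) A = emeasure \<nu>QSD A" by simp
  qed (simp only: sets sets_QSD)
  then show ?thesis
    using Q.nn_integral_push[OF sets_QSD state_nonempty f] by simp
qed

lemma K_phi2_pos: "x \<in> K \<Longrightarrow> 0 < \<phi>2 x"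
proof -
  assume x: "x \<in> K"
  have "(INF x\<in>K. \<phi>2 x) \<le> \<phi>2 x"
    using x K_state phi_nonneg(2) by (intro cINF_lower) (auto intro!: bdd_belowI[of _ 0])
  with E2_phi2(1) show ?thesis by linarith
qed

lemma expansion:
  assumes x: "x \<in> space (stateM X)"
  shows "ennreal (\<theta>2 / \<theta>0) * ennreal (\<phi>2 x) \<le> Q.Q (\<lambda>y. ennreal (\<phi>2 y)) x"
proof -
  have "ennreal (\<theta>2 / \<theta>0) * ennreal (\<phi>2 x) = r * ennreal (\<theta>2 * \<phi>2 x)"
    using theta0 consts_pos phi_nonneg(2)[OF x] by (simp flip: ennreal_mult)
  also have "\<dots> \<le> r * semigrp X 1 \<phi>2 x"
    using E2_P1_phi2[OF x] by (intro mult_left_mono) auto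
  also have "\<dots> = Q.Q (\<lambda>y. ennreal (\<phi>2 y)) x"
    using Q_pow_semigrp[OF x phi_measurable(2), of 1] by simp
  finally show ?thesis .
qed

text \<open>
  Both \<open>\<alpha>(P \<phi>2) = \<theta>0 \<alpha>(\<phi>2)\<close> and \<open>\<alpha>(P \<phi>2) \<ge> \<theta>2 \<alpha>(\<phi>2)\<close> hold, and \<open>0 < \<alpha>(\<phi>2) \<le> 1\<close>.
\<close>

lemma theta2_le_theta0: "\<theta>2 \<le> \<theta>0"
proof -
  interpret prob_space \<nu>QSD by (rule prob_QSD)
  let ?I = "\<integral>\<^sup>+x. ennreal (\<phi>2 x) \<partial>\<nu>QSD"
  have "?I \<le> (\<integral>\<^sup>+x. 1 \<partial>\<nu>QSD)"
    using E2_phi2(2) space_QSD by (intro nn_integral_mono) auto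
  then have "?I \<le> 1" by (simp add: emeasure_space_1)
  then obtain t where t: "?I = ennreal t" "0 < t"
    using QSD(3) by (cases ?I) (auto simp: top_unique)
  have m: "(\<lambda>x. ennreal (\<phi>2 x)) \<in> borel_measurable \<nu>QSD"
    using phi_measurable(2) sets_QSD by (simp cong: measurable_cong_sets)
  have "ennreal (\<theta>2 / \<theta>0) * ?I = (\<integral>\<^sup>+x. ennreal (\<theta>2 / \<theta>0) * ennreal (\<phi>2 x) \<partial>\<nu>QSD)"
    using m by (simp add: nn_integral_cmult)
  also have "\<dots> \<le> (\<integral>\<^sup>+x. Q.Q (\<lambda>y. ennreal (\<phi>2 y)) x \<partial>\<nu>QSD)"
    using expansion by (intro nn_integral_mono) (simp add: space_QSD)
  also have "\<dots> = ?I" using phi_measurable(2) by (intro QSD_Q) auto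
  finally have "\<theta>2 / \<theta>0 * t \<le> t"
    using t theta0 consts_pos by (simp flip: ennreal_mult)
  then show ?thesis using t theta0 by (simp add: field_simps)
qed

text \<open>
  In the quotient of (E3) the value \<open>0 / 0\<close> is \<open>0\<close>, so a vanishing denominator forces a vanishing
  numerator and the inequality survives.
\<close>

lemma harnack_alive:
  assumes x: "x \<in> K" and y: "y \<in> K"
  shows "ennreal (prob_from X x (alive X n)) \<le> ennreal c3 * ennreal (prob_from X y (alive X n))"
proof -
  let ?p = "\<lambda>y. ennreal (prob_from X y (alive X n))"
  let ?S = "SUP y\<in>K. ?p y" and ?I = "INF y\<in>K. ?p y"
  have "?S / ?I \<le> (SUP n. (SUP y\<in>K. ennreal (prob_from X y (alive X n))) /
                     (INF y\<in>K. ennreal (prob_from X y (alive X n))))"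
    by (rule SUP_upper2[of n]) auto
  also note E3
  finally have SI: "?S / ?I \<le> ennreal c3" .
  have I_fin: "?I < \<infinity>"
    using INF_lower[OF x, of ?p] by (rule le_less_trans) simp
  have "?S \<le> ennreal c3 * ?I"
  proof (cases "?I = 0")
    case True
    have "?S = 0"
    proof (rule ccontr)
      assume "?S \<noteq> 0"
      then have "?S / ?I = \<infinity>" using True by (simp add: ennreal_divide_zero)
      with SI show False by (simp add: top_unique)
    qed
    then show ?thesis by simp
  next
    case False
    have "?S = ?S / ?I * ?I"
      using False I_fin by (simp add: ennreal_divide_times ennreal_mult_divide_eq)
    also have "\<dots> \<le> ennreal c3 * ?I" using SI by (rule mult_right_mono) simp
    finally show ?thesis .
  qed
  then show ?thesis
    using SUP_upper[OF x, of ?p] INF_lower[OF y, of ?p]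
    by (meson mult_left_mono order_trans zero_le)
qed

text \<open>
  Any function with a drift factor below \<open>\<theta>0\<close> may take the place of \<open>\<phi>1\<close>; it is used for
  \<open>\<phi>1\<close> itself and for its powers. All constants of Assumption (E) get divided by the powers of
  \<open>\<theta>0\<close> that the scaling of the kernel produces.
\<close>

lemma lyapunov_instance:
  fixes \<phi> :: "'a \<Rightarrow> real" and \<theta> b :: real
  assumes \<phi>: "\<phi> \<in> borel_measurable (stateM X)" "\<And>x. x \<in> space (stateM X) \<Longrightarrow> 1 \<le> \<phi> x"
    and \<theta>: "0 \<le> \<theta>" "\<theta> < \<theta>0" and b: "0 \<le> b"
    and drift: "\<And>x. x \<in> space (stateM X) \<Longrightarrow> semigrp X 1 \<phi> x \<le> ennreal (\<theta> * \<phi> x + b * indicator K x)"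
    and fin: "(\<integral>\<^sup>+x. ennreal (\<phi> x) \<partial>\<nu>QSD) < \<infinity>"
  shows "lyapunov_kernel (stateM X) (transition 1) r (\<lambda>x. ennreal (\<phi> x)) (\<lambda>x. ennreal (\<eta> x)) K
    \<nu>QSD \<nu>K (\<theta> / \<theta>0) (b / \<theta>0) (c1 / \<theta>0 ^ n1) c3 n1"
proof
  show "(\<lambda>x. ennreal (\<phi> x)) \<in> borel_measurable (stateM X)" using \<phi> by simp
  show "K \<in> sets (stateM X)" by (rule K_sets)
  show "1 \<le> ennreal (\<phi> x)" if "x \<in> space (stateM X)" for x
    using \<phi>(2)[OF that] by simp
  show "Q.Q (\<lambda>x. ennreal (\<phi> x)) x \<le> ennreal (\<theta> / \<theta>0) * ennreal (\<phi> x) + ennreal (b / \<theta>0) * indicator K x"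
    if x: "x \<in> space (stateM X)" for x
  proof -
    have "Q.Q (\<lambda>x. ennreal (\<phi> x)) x = r * semigrp X 1 \<phi> x"
      using Q_pow_semigrp[OF x \<phi>(1), of 1] by simp
    also have "\<dots> \<le> r * ennreal (\<theta> * \<phi> x + b * indicator K x)"
      using drift[OF x] by (intro mult_left_mono) auto
    also have "\<dots> = ennreal (1 / \<theta>0 * (\<theta> * \<phi> x + b * indicator K x))"
      using theta0 by (subst ennreal_mult') auto
    also have "1 / \<theta>0 * (\<theta> * \<phi> x + b * indicator K x) = \<theta> / \<theta>0 * \<phi> x + b / \<theta>0 * indicator K x"
      by (simp add: distrib_left)
    also have "ennreal \<dots> = ennreal (\<theta> / \<theta>0) * ennreal (\<phi> x) + ennreal (b / \<theta>0) * indicator K x"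
      using theta0 \<theta> b \<phi>(2)[OF x]
      by (cases "x \<in> K") (simp_all add: ennreal_mult[symmetric] ennreal_plus[symmetric] del: ennreal_plus)
    finally show ?thesis .
  qed
  show "sets \<nu>K = sets (stateM X)" by (simp add: \<nu>K_def)
  show "emeasure \<nu>K (space (stateM X)) = 1"
  proof -
    have "space (stateM X) \<inter> K = space \<nu>" using K_state nu_facts(3) by auto
    then show ?thesis
      using emeasure_nuK[OF sets.top] prob_space.prob_space[OF nu_facts(2)] by simp
  qed
  show "AE x in \<nu>K. x \<in> K"
    unfolding \<nu>K_def using K_sets nu_facts(3)
    by (subst AE_distr_iff[OF id_measurable_nu]) (auto intro!: AE_I2 simp: Int_def[symmetric] sets.Int_space_eq1)
  show "ennreal (c1 / \<theta>0 ^ n1) * (\<integral>\<^sup>+y. f y \<partial>\<nu>K) \<le> (Q.Q ^^ n1) f x"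
    if x: "x \<in> K" and f: "f \<in> borel_measurable (stateM X)" for x f
  proof -
    note xs = K_state[OF x]
    obtain a where a: "\<And>f. f \<in> borel_measurable (stateM X) \<Longrightarrow>
        (\<integral>\<^sup>+y. f y \<partial>transition n1 x) = (\<integral>\<^sup>+y. f y \<partial>a) + ennreal c1 * (\<integral>\<^sup>+y. f y \<partial>\<nu>K)"
    proof (rule subtract_minorant[of "transition n1 x" "stateM X" \<nu>K "ennreal c1"])
      show "ennreal c1 * emeasure \<nu>K A \<le> emeasure (transition n1 x) A" if A: "A \<in> sets (stateM X)" for A
        using E1[OF x stateM_in_extM[OF A]] prob_from_hits[OF state_in_ext[OF xs] A, of n1] consts_pos
        by (simp add: emeasure_nuK[OF A] emeasure_eq_measure_transition[OF xs] ennreal_leI flip: ennreal_mult)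
    qed (use emeasure_eq_measure_transition[OF xs] in \<open>auto simp: \<nu>K_def\<close>)
    have "ennreal (c1 / \<theta>0 ^ n1) * (\<integral>\<^sup>+y. f y \<partial>\<nu>K) = ennreal (1 / \<theta>0 ^ n1) * (ennreal c1 * (\<integral>\<^sup>+y. f y \<partial>\<nu>K))"
      using theta0 consts_pos by (simp add: mult.assoc[symmetric] ennreal_mult[symmetric])
    also have "\<dots> \<le> ennreal (1 / \<theta>0 ^ n1) * (\<integral>\<^sup>+y. f y \<partial>transition n1 x)"
      unfolding a[OF f] by (intro mult_left_mono) auto
    also have "\<dots> = (Q.Q ^^ n1) f x" using Q_pow_eq[OF xs f] by simp
    finally show ?thesis .
  qed
  show "(Q.Q ^^ n) (\<lambda>_. 1) x \<le> ennreal c3 * (Q.Q ^^ n) (\<lambda>_. 1) y" if x: "x \<in> K" and y: "y \<in> K" for n x y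
  proof -
    have "prob_from X x (alive X n) \<le> c3 * prob_from X y (alive X n)"
      using harnack_alive[OF x y, of n] consts_pos by (simp add: prob_from_def flip: ennreal_mult)
    then have "prob_from X x (alive X n) / \<theta>0 ^ n \<le> c3 * prob_from X y (alive X n) / \<theta>0 ^ n"
      using theta0 by (intro divide_right_mono) auto
    then have "ennreal (prob_from X x (alive X n) / \<theta>0 ^ n) \<le> ennreal (c3 * (prob_from X y (alive X n) / \<theta>0 ^ n))"
      by (intro ennreal_leI) simp
    also have "\<dots> = ennreal c3 * ennreal (prob_from X y (alive X n) / \<theta>0 ^ n)"
      using consts_pos theta0 by (intro ennreal_mult) (auto simp: prob_from_def)
    finally show ?thesis
      unfolding Q_pow_one[OF K_state[OF x]] Q_pow_one[OF K_state[OF y]] .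
  qed
  show "\<exists>m. \<forall>n\<ge>m. 0 < (Q.Q ^^ n) (indicator K) x" if x: "x \<in> K" for x
  proof -
    obtain m where m: "\<And>n. m \<le> n \<Longrightarrow> 0 < prob_from X x (hits X n K)"
      using E4[OF x] by blast
    have "0 < (Q.Q ^^ n) (indicator K) x" if "m \<le> n" for n
      unfolding Q_pow_indicator[OF K_state[OF x] K_sets]
      using m[OF that] theta0 by (simp add: prob_from_hits[OF state_in_ext[OF K_state[OF x]] K_sets])
    then show ?thesis by blast
  qed
  show "sets \<nu>QSD = sets (stateM X)" by (rule sets_QSD)
  show "emeasure \<nu>QSD (space (stateM X)) = 1"
    using prob_space.emeasure_space_1[OF prob_QSD] space_QSD by simp
  show "(\<integral>\<^sup>+x. Q.Q f x \<partial>\<nu>QSD) = (\<integral>\<^sup>+x. f x \<partial>\<nu>QSD)" if "f \<in> borel_measurable (stateM X)" for f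
    using that by (rule QSD_Q)
  show "(\<lambda>n. (Q.Q ^^ n) (\<lambda>_. 1) x) \<longlonglongrightarrow> ennreal (\<eta> x)" if x: "x \<in> space (stateM X)" for x
    unfolding Q_pow_one[OF x] using eta_limit[OF x] by (rule tendsto_ennrealI)
qed (use \<theta> b theta0 consts_pos fin in \<open>auto simp: field_simps\<close>)

definition E' :: "'a set" where
  "E' = {x \<in> space (stateM X). 0 < \<eta> x}"

lemma eta_measurable: "\<eta> \<in> borel_measurable (stateM X)"
proof (rule borel_measurable_LIMSEQ_metric[OF _ eta_limit])
  fix n
  have "(\<lambda>x. measure (transition n x) (space (stateM X)) / \<theta>0 ^ n) \<in> borel_measurable (stateM X)"
    by (intro borel_measurable_divide borel_measurable_const
         measure_measurable_subprob_algebra2[OF _ transition_kernel[OF state_nonempty]])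
       (auto intro!: pair_measureI)
  then show "(\<lambda>x. prob_from X x (alive X n) / \<theta>0 ^ n) \<in> borel_measurable (stateM X)"
    by (rule measurable_cong[THEN iffD1, rotated]) (simp add: prob_from_alive state_in_ext)
qed

lemma E'_sets: "E' \<in> sets (stateM X)"
  unfolding E'_def using eta_measurable by measurable

lemma lyapunov_phi1:
  "lyapunov_kernel (stateM X) (transition 1) r (\<lambda>x. ennreal (\<phi>1 x)) (\<lambda>x. ennreal (\<eta> x)) K
    \<nu>QSD \<nu>K (\<theta>1 / \<theta>0) (c2 / \<theta>0) (c1 / \<theta>0 ^ n1) c3 n1"
  using phi_measurable(1) E2_phi1(1) consts_pos E2_theta theta2_le_theta0 E2_P1_phi1 QSD(2)
  by (intro lyapunov_instance) auto

lemma E'_eq: "E' = {x \<in> space (stateM X). \<exists>k. semigrp X k \<phi>2 x > 0}"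
proof -
  interpret L: lyapunov_kernel "stateM X" "transition 1" r "\<lambda>x. ennreal (\<phi>1 x)" "\<lambda>x. ennreal (\<eta> x)" K
    \<nu>QSD \<nu>K "\<theta>1 / \<theta>0" "c2 / \<theta>0" "c1 / \<theta>0 ^ n1" c3 n1
    by (rule lyapunov_phi1)
  have "0 < \<eta> x \<longleftrightarrow> (\<exists>k. semigrp X k \<phi>2 x > 0)" if x: "x \<in> space (stateM X)" for x
  proof -
    have "0 < ennreal (\<eta> x) \<longleftrightarrow> (\<exists>k. 0 < (Q.Q ^^ k) (\<lambda>y. ennreal (\<phi>2 y)) x)"
      using expansion x theta0 theta2_le_theta0 E2_theta E2_phi2(2) K_phi2_pos phi_measurable(2)
      by (intro L.eta_pos_iff[where \<rho> = "\<theta>2 / \<theta>0"]) (auto simp: divide_strict_right_mono)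
    then show ?thesis
      using theta0 unfolding Q_pow_semigrp[OF x phi_measurable(2)] by (simp add: ennreal_zero_less_mult_iff)
  qed
  then show ?thesis by (auto simp: E'_def)
qed

lemma integral_eta_pos_iff:
  assumes \<mu>: "\<mu> \<in> space (prob_algebra (stateM X))"
  shows "0 < (\<integral>\<^sup>+x. ennreal (\<eta> x) \<partial>\<mu>) \<longleftrightarrow> 0 < measure \<mu> E'"
proof -
  have sets: "sets \<mu> = sets (stateM X)" and "prob_space \<mu>" using \<mu> by (auto simp: space_prob_algebra)
  then interpret prob_space \<mu> by simp
  have sp: "space \<mu> = space (stateM X)" using sets by (rule sets_eq_imp_space_eq)
  have m: "(\<lambda>x. ennreal (\<eta> x)) \<in> borel_measurable \<mu>"
    using eta_measurable sets by (simp cong: measurable_cong_sets)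
  have "(\<integral>\<^sup>+x. ennreal (\<eta> x) \<partial>\<mu>) = 0 \<longleftrightarrow> emeasure \<mu> {x \<in> space \<mu>. ennreal (\<eta> x) \<noteq> 0} = 0"
    using m by (rule nn_integral_0_iff)
  also have "{x \<in> space \<mu>. ennreal (\<eta> x) \<noteq> 0} = E'"
    using sp by (auto simp: E'_def ennreal_eq_0_iff not_le)
  finally show ?thesis by (auto simp: emeasure_eq_measure zero_less_iff_neq_zero measure_le_0_iff less_le)
qed

text \<open>
  With \<open>m n = \<theta>0\<^sup>-\<^sup>n \<mu> P\<^sup>n\<close> and \<open>h = \<mu>(\<eta>)\<close>, the deviation of \<open>m n\<close> from \<open>h \<alpha>\<close> is at most
  \<open>\<epsilon>\<close> in total variation, in particular \<open>\<bar>m n E - h\<bar> \<le> \<epsilon>\<close>. Normalising by \<open>m n E \<ge> h / 2\<close> costs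
  another \<open>\<epsilon>\<close>, which gives the bound \<open>4 \<epsilon> / h\<close> for the conditional laws.
\<close>

lemma attracted:
  fixes \<phi> :: "'a \<Rightarrow> real" and \<theta> b :: real
  assumes \<phi>: "\<phi> \<in> borel_measurable (stateM X)" "\<And>x. x \<in> space (stateM X) \<Longrightarrow> 1 \<le> \<phi> x"
    and \<theta>: "0 \<le> \<theta>" "\<theta> < \<theta>0" and b: "0 \<le> b"
    and drift: "\<And>x. x \<in> space (stateM X) \<Longrightarrow> semigrp X 1 \<phi> x \<le> ennreal (\<theta> * \<phi> x + b * indicator K x)"
    and fin: "(\<integral>\<^sup>+x. ennreal (\<phi> x) \<partial>\<nu>QSD) < \<infinity>"
    and \<mu>: "\<mu> \<in> space (prob_algebra (stateM X))" "0 < measure \<mu> E'" "(\<integral>\<^sup>+x. ennreal (\<phi> x) \<partial>\<mu>) < \<infinity>"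
  shows "\<mu> \<in> domain_of_attraction X \<nu>QSD"
proof -
  interpret L: lyapunov_kernel "stateM X" "transition 1" r "\<lambda>x. ennreal (\<phi> x)" "\<lambda>x. ennreal (\<eta> x)" K
    \<nu>QSD \<nu>K "\<theta> / \<theta>0" "b / \<theta>0" "c1 / \<theta>0 ^ n1" c3 n1
    by (rule lyapunov_instance) fact+
  let ?M = "stateM X" and ?E = "space (stateM X)"
  have sets: "sets \<mu> = sets ?M" using \<mu> by (auto simp: space_prob_algebra)
  have sp: "space \<mu> = ?E" using sets by (rule sets_eq_imp_space_eq)
  interpret QSD: prob_space \<nu>QSD by (rule prob_QSD)
  obtain h where h: "(\<integral>\<^sup>+x. ennreal (\<eta> x) \<partial>\<mu>) = ennreal h" "0 < h"
    using integral_eta_pos_iff[OF \<mu>(1)] \<mu>(2) L.integral_u_tendsto(2)[OF sets \<mu>(3)]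
    by (cases "\<integral>\<^sup>+x. ennreal (\<eta> x) \<partial>\<mu>") auto
  define m where "m n A = prob_init X \<mu> (hits X n A \<inter> alive X n) / \<theta>0 ^ n" for n A
  have m: "(\<integral>\<^sup>+x. (Q.Q ^^ n) (indicator A) x \<partial>\<mu>) = ennreal (m n A)" "0 \<le> m n A" if A: "A \<in> sets ?M" for n A
  proof -
    have "(\<integral>\<^sup>+x. (Q.Q ^^ n) (indicator A) x \<partial>\<mu>) = (\<integral>\<^sup>+x. ennreal (1 / \<theta>0 ^ n) * emeasure (transition n x) A \<partial>\<mu>)"
    proof (intro nn_integral_cong)
      fix x assume "x \<in> space \<mu>"
      then show "(Q.Q ^^ n) (indicator A) x = ennreal (1 / \<theta>0 ^ n) * emeasure (transition n x) A"
        using Q_pow_eq[of x "indicator A" n] A unfolding sp by simp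
    qed
    also have "\<dots> = ennreal (1 / \<theta>0 ^ n) * (\<integral>\<^sup>+x. emeasure (transition n x) A \<partial>\<mu>)"
    proof (rule nn_integral_cmult)
      have "(\<lambda>x. emeasure (transition n x) A) \<in> borel_measurable ?M"
        using transition_kernel[OF state_nonempty] A by (rule measurable_emeasure_kernel)
      then show "(\<lambda>x. emeasure (transition n x) A) \<in> borel_measurable \<mu>"
        using sets by (simp cong: measurable_cong_sets)
    qed
    also have "\<dots> = ennreal (m n A)"
      unfolding prob_init_hits_alive[OF \<mu>(1) A, symmetric] m_def
      using theta0 prob_init_nonneg by (simp add: ennreal_mult[symmetric])
    finally show "(\<integral>\<^sup>+x. (Q.Q ^^ n) (indicator A) x \<partial>\<mu>) = ennreal (m n A)" .
    show "0 \<le> m n A" using theta0 prob_init_nonneg by (simp add: m_def)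
  qed
  have cond: "cond_law X \<mu> n A = m n A / m n ?E" for n A
    using theta0 by (simp add: cond_law_def m_def hits_space_Int_alive)
  have tv: "\<exists>n0. \<forall>n\<ge>n0. tv_norm ?M (\<lambda>A. cond_law X \<mu> n A - measure \<nu>QSD A) \<le> ennreal \<delta>"
    if \<delta>: "0 < \<delta>" for \<delta> :: real
  proof -
    (* The first bound keeps the normalising mass above h / 2, the second turns 4 * eps / h into delta. *)
    define \<epsilon> where "\<epsilon> = min (h / 2) (h * \<delta> / 4)"
    have \<epsilon>: "0 < \<epsilon>" "\<epsilon> \<le> h / 2" "4 * \<epsilon> \<le> h * \<delta>" using h \<delta> by (auto simp: \<epsilon>_def)
    obtain n0 where n0: "\<And>n. n0 \<le> n \<Longrightarrow> \<exists>a b. sets a = sets ?M \<and> sets b = sets ?M \<and>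
        emeasure a ?E + emeasure b ?E \<le> ennreal \<epsilon> \<and>
        (\<forall>f\<in>borel_measurable ?M. (\<integral>\<^sup>+x. (Q.Q ^^ n) f x \<partial>\<mu>) + (\<integral>\<^sup>+x. f x \<partial>b)
          = (\<integral>\<^sup>+x. ennreal (\<eta> x) \<partial>\<mu>) * (\<integral>\<^sup>+x. f x \<partial>\<nu>QSD) + (\<integral>\<^sup>+x. f x \<partial>a))"
      using L.convergence_to_alpha[OF sets \<mu>(3) \<epsilon>(1)] by blast
    have "tv_norm ?M (\<lambda>A. cond_law X \<mu> n A - measure \<nu>QSD A) \<le> ennreal \<delta>" if n: "n0 \<le> n" for n
    proof -
      obtain a b where ab: "sets a = sets ?M" "sets b = sets ?M"
          "emeasure a ?E + emeasure b ?E \<le> ennreal \<epsilon>"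
          "\<And>f. f \<in> borel_measurable ?M \<Longrightarrow> (\<integral>\<^sup>+x. (Q.Q ^^ n) f x \<partial>\<mu>) + (\<integral>\<^sup>+x. f x \<partial>b)
            = ennreal h * (\<integral>\<^sup>+x. f x \<partial>\<nu>QSD) + (\<integral>\<^sup>+x. f x \<partial>a)"
        using n0[OF n] unfolding h(1) by blast
      have "emeasure a ?E < \<infinity>" "emeasure b ?E < \<infinity>"
        using ab(3) by (auto simp: top_unique less_top dest: le_less_trans[OF _ ennreal_less_top])
      moreover have "space a = ?E" "space b = ?E" using ab by (auto dest: sets_eq_imp_space_eq)
      ultimately have fm: "finite_measure a" "finite_measure b"
        by (auto intro!: finite_measureI)
      interpret a: finite_measure a by (rule fm)
      interpret b: finite_measure b by (rule fm)
      have total: "measure a ?E + measure b ?E \<le> \<epsilon>"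
        using ab(3) \<epsilon> by (simp add: a.emeasure_eq_measure b.emeasure_eq_measure flip: ennreal_plus)
      have dev: "\<bar>m n A - h * measure \<nu>QSD A\<bar> \<le> measure a A + measure b A" if A: "A \<in> sets ?M" for A
      proof -
        have "ennreal (m n A + measure b A) = ennreal (h * measure \<nu>QSD A + measure a A)"
          using ab(4)[of "indicator A"] A m[OF A] ab(1,2) sets_QSD h
          by (simp add: a.emeasure_eq_measure b.emeasure_eq_measure QSD.emeasure_eq_measure ennreal_mult)
        then have "m n A + measure b A = h * measure \<nu>QSD A + measure a A"
          using m(2)[OF A] h by (subst (asm) ennreal_inj) auto
        then show ?thesis
          using measure_nonneg[of a A] measure_nonneg[of b A] unfolding abs_le_iff by linarith
      qed
      have QSD1: "measure \<nu>QSD ?E = 1" using QSD.prob_space space_QSD by simp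
      have devE: "\<bar>m n ?E - h\<bar> \<le> \<epsilon>" using dev[OF sets.top] total QSD1 by simp
      then have mE: "h / 2 \<le> m n ?E" using \<epsilon>(2) by linarith
      then have mE0: "0 < m n ?E" using h by linarith
      have "(\<Sum>A\<in>\<P>. \<bar>cond_law X \<mu> n A - measure \<nu>QSD A\<bar>) \<le> \<delta>"
        if P: "finite \<P>" "\<P> \<subseteq> sets ?M" "disjoint \<P>" "\<Union>\<P> = ?E" for \<P>
      proof -
        (* Split off the error of the normalising constant, weighted by the limit law. *)
        have "\<bar>cond_law X \<mu> n A - measure \<nu>QSD A\<bar>
            \<le> (measure a A + measure b A + \<epsilon> * measure \<nu>QSD A) / m n ?E" if A: "A \<in> \<P>" for A
        proof -
          have "cond_law X \<mu> n A - measure \<nu>QSD A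
              = ((m n A - h * measure \<nu>QSD A) + (h - m n ?E) * measure \<nu>QSD A) / m n ?E"
            using mE0 by (simp add: cond field_simps)
          also have "\<bar>\<dots>\<bar> \<le> (\<bar>m n A - h * measure \<nu>QSD A\<bar> + \<bar>h - m n ?E\<bar> * measure \<nu>QSD A) / m n ?E"
            using mE0 abs_triangle_ineq[of "m n A - h * measure \<nu>QSD A" "(h - m n ?E) * measure \<nu>QSD A"]
            by (simp add: abs_mult divide_right_mono)
          also have "\<dots> \<le> (measure a A + measure b A + \<epsilon> * measure \<nu>QSD A) / m n ?E"
            using mE0 dev A P(2) devE
            by (intro divide_right_mono add_mono mult_right_mono) (auto simp: abs_minus_commute)
          finally show ?thesis .
        qed
        then have "(\<Sum>A\<in>\<P>. \<bar>cond_law X \<mu> n A - measure \<nu>QSD A\<bar>)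
            \<le> (\<Sum>A\<in>\<P>. (measure a A + measure b A + \<epsilon> * measure \<nu>QSD A) / m n ?E)"
          by (rule sum_mono)
        also have "\<dots> = ((\<Sum>A\<in>\<P>. measure a A) + (\<Sum>A\<in>\<P>. measure b A) + \<epsilon> * (\<Sum>A\<in>\<P>. measure \<nu>QSD A)) / m n ?E"
          by (simp add: sum_divide_distrib[symmetric] sum.distrib sum_distrib_left)
        also have "\<dots> = (measure a ?E + measure b ?E + \<epsilon>) / m n ?E"
          using sum_measure_partition[OF fm(1) ab(1) P] sum_measure_partition[OF fm(2) ab(2) P]
            sum_measure_partition[OF QSD.finite_measure_axioms sets_QSD P] QSD1 by simp
        also have "\<dots> \<le> (2 * \<epsilon>) / (h / 2)"
          using total mE h \<epsilon>(1) by (intro frac_le) auto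
        also have "\<dots> \<le> \<delta>" using \<epsilon>(3) h by (simp add: field_simps)
        finally show ?thesis .
      qed
      then show ?thesis
        unfolding tv_norm_def by (auto intro!: SUP_least ennreal_leI)
    qed
    then show ?thesis by blast
  qed
  have "(\<lambda>n. tv_norm ?M (\<lambda>A. cond_law X \<mu> n A - measure \<nu>QSD A)) \<longlonglongrightarrow> 0"
  proof (rule tendsto_zero_ennreal)
    fix \<delta> :: real assume \<delta>: "0 < \<delta>"
    then have "ennreal (\<delta> / 2) < ennreal \<delta>" by (simp add: ennreal_less_iff)
    then show "eventually (\<lambda>n. tv_norm ?M (\<lambda>A. cond_law X \<mu> n A - measure \<nu>QSD A) < ennreal \<delta>) sequentially"
      using tv[of "\<delta> / 2"] \<delta> by (auto simp: eventually_sequentially intro: le_less_trans)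
  qed
  with \<mu>(1) show ?thesis by (simp add: domain_of_attraction_def)
qed

text \<open>
  If \<open>\<mu>(E') = 0\<close>, the identity \<open>E'_eq\<close> shows that \<open>\<phi>2 (X\<^sub>n)\<close> vanishes almost surely on survival, for every
  \<open>n\<close>. The conditional laws therefore miss the set \<open>{\<phi>2 > 0}\<close>, to which \<open>\<nu>QSD\<close> gives positive mass.
\<close>

lemma attracted_gives_mass:
  assumes "\<mu> \<in> domain_of_attraction X \<nu>QSD"
  shows "0 < measure \<mu> E'"
proof (rule ccontr)
  assume no: "\<not> 0 < measure \<mu> E'"
  have \<mu>: "\<mu> \<in> space (prob_algebra (stateM X))"
    and lim: "(\<lambda>n. tv_norm (stateM X) (\<lambda>A. cond_law X \<mu> n A - measure \<nu>QSD A)) \<longlonglongrightarrow> 0"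
    using assms by (auto simp: domain_of_attraction_def)
  have sets: "sets \<mu> = sets (stateM X)" and "prob_space \<mu>" using \<mu> by (auto simp: space_prob_algebra)
  then interpret prob_space \<mu> by simp
  interpret QSD: prob_space \<nu>QSD by (rule prob_QSD)
  have sp: "space \<mu> = space (stateM X)" using sets by (rule sets_eq_imp_space_eq)
  define A where "A = {x \<in> space (stateM X). 0 < \<phi>2 x}"
  have A: "A \<in> sets (stateM X)" unfolding A_def using phi_measurable(2) by measurable
  have "emeasure \<mu> E' = 0" using no by (simp add: emeasure_eq_measure zero_less_measure_iff)
  then have "AE x in \<mu>. x \<notin> E'" using E'_sets sets by (intro AE_not_in) (auto simp: null_sets_def)
  have zero: "cond_law X \<mu> n A = 0" for n
  proof -
    have "AE x in \<mu>. emeasure (transition n x) A = 0"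
      using \<open>AE x in \<mu>. x \<notin> E'\<close> AE_space
    proof eventually_elim
      case (elim x)
      then have x: "x \<in> space (stateM X)" by (simp add: sp)
      have "semigrp X n \<phi>2 x = 0" using elim(1) x by (auto simp: E'_eq zero_less_iff_neq_zero)
      then have "(\<integral>\<^sup>+y. ennreal (\<phi>2 y) \<partial>transition n x) = 0"
        using semigrp_eq[OF state_in_ext[OF x] phi_measurable(2)] by simp
      then have "emeasure (transition n x) {y \<in> space (transition n x). ennreal (\<phi>2 y) \<noteq> 0} = 0"
        using phi_measurable(2) by (subst (asm) nn_integral_0_iff) auto
      moreover have "{y \<in> space (transition n x). ennreal (\<phi>2 y) \<noteq> 0} = A"
        by (auto simp: A_def ennreal_eq_0_iff not_le)
      ultimately show ?case by simp
    qed
    then have "(\<integral>\<^sup>+x. emeasure (transition n x) A \<partial>\<mu>) = (\<integral>\<^sup>+x. 0 \<partial>\<mu>)"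
      by (intro nn_integral_cong_AE) auto
    then have "ennreal (prob_init X \<mu> (hits X n A \<inter> alive X n)) = 0"
      using prob_init_hits_alive[OF \<mu> A, of n] by simp
    then have "prob_init X \<mu> (hits X n A \<inter> alive X n) = 0"
      using prob_init_nonneg[of \<mu> "hits X n A \<inter> alive X n"] by (simp add: ennreal_eq_0_iff)
    then show ?thesis by (simp add: cond_law_def)
  qed
  have "ennreal (measure \<nu>QSD A) \<le> tv_norm (stateM X) (\<lambda>A. cond_law X \<mu> n A - measure \<nu>QSD A)" for n
    using tv_norm_ge[OF A, of "\<lambda>A. cond_law X \<mu> n A - measure \<nu>QSD A"] zero by simp
  then have "ennreal (measure \<nu>QSD A) \<le> 0"
    using lim by (intro LIMSEQ_le_const) auto
  then have "emeasure \<nu>QSD A = 0" by (simp add: QSD.emeasure_eq_measure)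
  moreover have "(\<lambda>x. ennreal (\<phi>2 x)) \<in> borel_measurable \<nu>QSD"
    using phi_measurable(2) sets_QSD by (simp cong: measurable_cong_sets)
  moreover have "{x \<in> space \<nu>QSD. ennreal (\<phi>2 x) \<noteq> 0} = A"
    by (auto simp: A_def space_QSD ennreal_eq_0_iff not_le)
  ultimately have "(\<integral>\<^sup>+x. ennreal (\<phi>2 x) \<partial>\<nu>QSD) = 0"
    by (simp add: nn_integral_0_iff)
  with QSD(3) show False by simp
qed

lemma QSD_mass: "0 < measure \<nu>QSD E'"
proof -
  interpret L: lyapunov_kernel "stateM X" "transition 1" r "\<lambda>x. ennreal (\<phi>1 x)" "\<lambda>x. ennreal (\<eta> x)" K
    \<nu>QSD \<nu>K "\<theta>1 / \<theta>0" "c2 / \<theta>0" "c1 / \<theta>0 ^ n1" c3 n1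
    by (rule lyapunov_phi1)
  show ?thesis using L.alpha_eta integral_eta_pos_iff[OF QSD_prob] by simp
qed

text \<open>
  The drift condition for \<open>\<phi>1 powr q\<close> follows from Jensen's inequality and the subadditivity of
  \<open>t \<mapsto> t powr q\<close> on the right-hand side \<open>\<theta>1 \<phi>1 + c2 1\<^sub>K\<close>.
\<close>

lemma attracted_moment:
  assumes \<mu>: "\<mu> \<in> space (prob_algebra (stateM X))" "0 < measure \<mu> E'"
    and p: "1 \<le> p" "ereal p < log_quotient \<theta>1 \<theta>2" "(\<integral>\<^sup>+x. ennreal (\<phi>1 x powr (1 / p)) \<partial>\<mu>) < \<infinity>"
  shows "\<mu> \<in> domain_of_attraction X \<nu>QSD"
proof -
  define q where "q = 1 / p"
  have q: "0 < q" "q \<le> 1" using p by (auto simp: q_def)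
  have \<theta>: "\<theta>1 powr q < \<theta>2"
    unfolding q_def using consts_pos E2_theta theta2_le_theta0 theta0 p
    by (intro powr_less_if_less_log_quotient) auto
  have le: "\<phi>1 x powr q \<le> \<phi>1 x" if "x \<in> space (stateM X)" for x
    using powr_mono[of q 1 "\<phi>1 x"] E2_phi1(1)[OF that] q by simp
  have drift: "semigrp X 1 (\<lambda>x. \<phi>1 x powr q) x \<le> ennreal (\<theta>1 powr q * \<phi>1 x powr q + c2 powr q * indicator K x)"
    if x: "x \<in> space (stateM X)" for x
  proof -
    have \<phi>1: "1 \<le> \<phi>1 x" using E2_phi1(1)[OF x] .
    define t where "t = \<theta>1 * \<phi>1 x + c2 * indicator K x"
    have pos: "0 < \<theta>1 * \<phi>1 x" using \<phi>1 consts_pos by simp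
    then have t: "0 < t" using consts_pos by (auto simp: t_def split: split_indicator)
    have "(\<integral>\<^sup>+y. ennreal (\<phi>1 y) \<partial>transition 1 x) \<le> ennreal t"
      using E2_P1_phi1[OF x] semigrp_eq[OF state_in_ext[OF x] phi_measurable(1), of 1] by (simp add: t_def)
    then have "(\<integral>\<^sup>+y. ennreal (\<phi>1 y powr q) \<partial>transition 1 x) \<le> ennreal (t powr q)"
      using phi_measurable(1) t q E2_phi1(1)
      by (intro nn_integral_powr_le subprob_transition[OF x]) (auto intro: less_le_trans[OF zero_less_one])
    also have "t powr q \<le> \<theta>1 powr q * \<phi>1 x powr q + c2 powr q * indicator K x"
      using add_powr_le[OF pos consts_pos(4) q] consts_pos \<phi>1
      by (auto simp: t_def powr_mult split: split_indicator)
    finally show ?thesis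
      using semigrp_eq[OF state_in_ext[OF x], of "\<lambda>x. \<phi>1 x powr q" 1] phi_measurable(1) by (simp add: ennreal_leI)
  qed
  show ?thesis
  proof (rule attracted[OF _ _ _ _ _ drift _ \<mu>])
    show "(\<lambda>x. \<phi>1 x powr q) \<in> borel_measurable (stateM X)" using phi_measurable(1) by measurable
    show "1 \<le> \<phi>1 x powr q" if "x \<in> space (stateM X)" for x
      using ge_one_powr_ge_zero[OF E2_phi1(1)[OF that]] q by simp
    have "(\<integral>\<^sup>+x. ennreal (\<phi>1 x powr q) \<partial>\<nu>QSD) \<le> (\<integral>\<^sup>+x. ennreal (\<phi>1 x) \<partial>\<nu>QSD)"
      using le space_QSD by (intro nn_integral_mono ennreal_leI) auto
    then show "(\<integral>\<^sup>+x. ennreal (\<phi>1 x powr q) \<partial>\<nu>QSD) < \<infinity>" using QSD(2) by (rule le_less_trans)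
    show "\<theta>1 powr q < \<theta>0" using \<theta> theta2_le_theta0 by simp
    show "(\<integral>\<^sup>+x. ennreal (\<phi>1 x powr q) \<partial>\<mu>) < \<infinity>" using p(3) by (simp add: q_def)
  qed auto
qed

lemma attracted_bounded:
  assumes bdd: "bdd_above (\<phi>1 ` space (stateM X))"
    and \<mu>: "\<mu> \<in> space (prob_algebra (stateM X))" "0 < measure \<mu> E'"
  shows "\<mu> \<in> domain_of_attraction X \<nu>QSD"
proof -
  have sets: "sets \<mu> = sets (stateM X)" and "prob_space \<mu>" using \<mu> by (auto simp: space_prob_algebra)
  then interpret prob_space \<mu> by simp
  have sp: "space \<mu> = space (stateM X)" using sets by (rule sets_eq_imp_space_eq)
  obtain B where B: "\<And>x. x \<in> space (stateM X) \<Longrightarrow> \<phi>1 x \<le> B" using bdd by (auto simp: bdd_above_def)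
  have "(\<integral>\<^sup>+x. ennreal (\<phi>1 x) \<partial>\<mu>) \<le> (\<integral>\<^sup>+x. ennreal B \<partial>\<mu>)"
    using B sp by (intro nn_integral_mono ennreal_leI) auto
  also have "\<dots> < \<infinity>" by (simp add: emeasure_space_1)
  finally show ?thesis
    using phi_measurable(1) E2_phi1(1) consts_pos E2_theta theta2_le_theta0 E2_P1_phi1 QSD(2) \<mu>
    by (intro attracted[of \<phi>1 \<theta>1 c2 \<mu>]) auto
qed

text \<open>
  The conditional laws of a quasi-stationary distribution do not move, so being attracted means being
  equal.
\<close>

lemma QSD_unique:
  assumes "quasi_stationary X \<nu>'" and attr: "\<nu>' \<in> domain_of_attraction X \<nu>QSD"
  shows "\<nu>' = \<nu>QSD"
proof (rule measure_eqI)
  have \<nu>': "\<nu>' \<in> space (prob_algebra (stateM X))" "\<And>n A. A \<in> sets (stateM X) \<Longrightarrow> cond_law X \<nu>' n A = measure \<nu>' A"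
    using assms(1) by (auto simp: quasi_stationary_def)
  have "prob_space \<nu>'" and sets: "sets \<nu>' = sets (stateM X)" using \<nu>'(1) by (auto simp: space_prob_algebra)
  then interpret prob_space \<nu>' by simp
  interpret QSD: prob_space \<nu>QSD by (rule prob_QSD)
  show "sets \<nu>' = sets \<nu>QSD" using sets sets_QSD by simp
  fix A assume "A \<in> sets \<nu>'"
  then have A: "A \<in> sets (stateM X)" using sets by simp
  have "ennreal \<bar>measure \<nu>' A - measure \<nu>QSD A\<bar> \<le> tv_norm (stateM X) (\<lambda>A. cond_law X \<nu>' n A - measure \<nu>QSD A)" for n
    using tv_norm_ge[OF A, of "\<lambda>A. cond_law X \<nu>' n A - measure \<nu>QSD A"] \<nu>'(2)[OF A] by simp
  then have "ennreal \<bar>measure \<nu>' A - measure \<nu>QSD A\<bar> \<le> 0"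
    using attr by (intro LIMSEQ_le_const) (auto simp: domain_of_attraction_def)
  then show "emeasure \<nu>' A = emeasure \<nu>QSD A"
    by (simp add: emeasure_eq_measure QSD.emeasure_eq_measure)
qed

end

theorem corollary2p5:
  fixes X :: "('w, 'a) process"
    and n1 :: nat and \<theta>1 \<theta>2 c1 c2 c3 \<theta>0 :: real
    and \<phi>1 \<phi>2 \<eta> :: "'a \<Rightarrow> real"
    and \<nu> \<nu>QSD :: "'a measure" and K E' :: "'a set"
  assumes "absorbed_markov_process X"
    and "assumption_E X n1 \<theta>1 \<theta>2 c1 c2 c3 \<phi>1 \<phi>2 \<nu> K"
    and nuQSD: "quasi_stationary X \<nu>QSD"
      "(\<integral>\<^sup>+x. ennreal (\<phi>1 x) \<partial>\<nu>QSD) < \<infinity>" "(\<integral>\<^sup>+x. ennreal (\<phi>2 x) \<partial>\<nu>QSD) > 0"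
    and theta0: "0 < \<theta>0" "\<theta>0 \<le> 1" "\<And>n. n \<ge> 1 \<Longrightarrow> prob_init X \<nu>QSD (alive X n) = \<theta>0 ^ n"
    and eta: "\<And>x. x \<in> space (stateM X) \<Longrightarrow>
      (\<lambda>n. prob_from X x (alive X n) / \<theta>0 ^ n) \<longlonglongrightarrow> \<eta> x"
    and E': "E' = {x \<in> space (stateM X). \<eta> x > 0}"
  shows "E' = {x \<in> space (stateM X). \<exists>k. semigrp X k \<phi>2 x > 0} \<and>
    (\<forall>\<mu> \<in> space (prob_algebra (stateM X)).
        measure \<mu> E' > 0 \<and>
        (\<exists>p::real. p \<ge> 1 \<and> ereal p < log_quotient \<theta>1 \<theta>2 \<and>
           (\<integral>\<^sup>+x. ennreal (\<phi>1 x powr (1 / p)) \<partial>\<mu>) < \<infinity>)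
        \<longrightarrow> \<mu> \<in> domain_of_attraction X \<nu>QSD) \<and>
    (bdd_above (\<phi>1 ` space (stateM X)) \<longrightarrow>
        domain_of_attraction X \<nu>QSD = {\<mu> \<in> space (prob_algebra (stateM X)). measure \<mu> E' > 0} \<and>
        quasi_stationary X \<nu>QSD \<and> measure \<nu>QSD E' > 0 \<and>
        (\<forall>\<nu>'. quasi_stationary X \<nu>' \<and> measure \<nu>' E' > 0 \<longrightarrow> \<nu>' = \<nu>QSD))"
proof -
  interpret S: qsd_setting X n1 \<theta>1 \<theta>2 c1 c2 c3 \<phi>1 \<phi>2 \<nu> K \<nu>QSD \<theta>0 \<eta>
    using assms(1-9) by (intro qsd_setting.intro qsd_setting_axioms.intro)
  have E'_eq: "E' = S.E'" by (simp add: E' S.E'_def)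
  have domain_prob: "\<mu> \<in> space (prob_algebra (stateM X))" if "\<mu> \<in> domain_of_attraction X \<nu>QSD" for \<mu>
    using that by (simp add: domain_of_attraction_def)
  show ?thesis
    unfolding E'_eq
  proof (intro conjI impI ballI allI)
    show "S.E' = {x \<in> space (stateM X). \<exists>k. semigrp X k \<phi>2 x > 0}" by (rule S.E'_eq)
  next
    fix \<mu> assume "\<mu> \<in> space (prob_algebra (stateM X))" "measure \<mu> S.E' > 0 \<and>
        (\<exists>p::real. p \<ge> 1 \<and> ereal p < log_quotient \<theta>1 \<theta>2 \<and>
           (\<integral>\<^sup>+x. ennreal (\<phi>1 x powr (1 / p)) \<partial>\<mu>) < \<infinity>)"
    then show "\<mu> \<in> domain_of_attraction X \<nu>QSD" using S.attracted_moment by blast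
  next
    assume "bdd_above (\<phi>1 ` space (stateM X))"
    then show "domain_of_attraction X \<nu>QSD = {\<mu> \<in> space (prob_algebra (stateM X)). measure \<mu> S.E' > 0}"
      using S.attracted_bounded S.attracted_gives_mass domain_prob by blast
  next
    fix \<nu>' assume bdd: "bdd_above (\<phi>1 ` space (stateM X))"
      and \<nu>': "quasi_stationary X \<nu>' \<and> measure \<nu>' S.E' > 0"
    then have "\<nu>' \<in> domain_of_attraction X \<nu>QSD"
      using S.attracted_bounded by (auto simp: quasi_stationary_def)
    with \<nu>' show "\<nu>' = \<nu>QSD" using S.QSD_unique by blast
  qed (use S.QSD_mass nuQSD in auto)
qed

end
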